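(* Let $V=\operatorname{Spec} A$ be a normal affine $\mathbb{C}^*$-surface over $\mathbb{C}$ carrying a $\mathbb{C}_+$-action, with DPD-presentation $A=\mathbb{C}[t][D_+,D_-]\subseteq\mathbb{C}(t)[u,u^{-1}]$, where $$D_+=-\frac{e_+}{d}[0]\ \text{ with }\ 0<e_+\le d,\qquad D_-=-\frac{e_-}{d}[0]-\frac1k D_0,$$ with integers $d,k\ge 1$, $e_+,e_-$, and with $D_0$ an integral divisor on $\mathbb{A}^1=\operatorname{Spec}\mathbb{C}[t]$ such that $D_0(0)=0$. Choose $Q\in\mathbb{C}[t]$ with $D_0=\operatorname{div}(Q)$ (so $Q(0)\ne 0$). Assume that one of the following conditions is satisfied: (i) $k=1$; (ii) $e_++e_-=0$, and $D_0$ is a reduced divisor. Then $V$ is equivariantly isomorphic to the principal open subset $\mathbb{D}_+(z)$ of the weighted projective hypersurface $\mathbb{V}_+(F)$ in the weighted projective space $\mathbb{P}=\mathbb{P}(e_+,\,ke_-+d\deg Q,\,d,\,1)$, where $$F=x^ky-s^{k(e_++e_-)}\,Q(s^d/z)\,z^{\deg Q}\in\mathbb{C}[x,y,z,s]$$ is weighted homogeneous with respect to the weights $\deg x=e_+$, $\deg y=ke_-+d\deg Q$, $\deg z=d$, $\deg s=1$.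
   Context: DPD-presentation: let $D_+,D_-$ be $\mathbb{Q}$-divisors on $\mathbb{A}^1=\operatorname{Spec}\mathbb{C}[t]$ with $D_++D_-\le 0$. Then $\mathbb{C}[t][D_+,D_-]=\bigoplus_{i\in\mathbb{Z}}A_i\subseteq\mathbb{C}(t)[u,u^{-1}]$ is the $\mathbb{Z}$-graded subring with, for $i\ge 0$, $$A_i=\{f\in\mathbb{C}(t)\mid \operatorname{div} f+iD_+\ge 0\}\,u^i,\qquad A_{-i}=\{f\in\mathbb{C}(t)\mid\operatorname{div} f+iD_-\ge 0\}\,u^{-i}$$ (with $0$ included in each piece). The $\mathbb{C}^*$-action on $V=\operatorname{Spec} A$ is the one defined by this $\mathbb{Z}$-grading. $D(0)$ denotes the coefficient of a divisor $D$ at the point $0\in\mathbb{A}^1$. The condition $D_++D_-\le 0$ gives $e_++e_-\ge 0$ and $D_0\geq 0$. The open subset $\mathbb{D}_+(z)=\{z\ne 0\}$ of $\mathbb{V}_+(F)=\{F=0\}\subseteq\mathbb{P}$ is $\operatorname{Spec}\,(R[1/z])_0$, where $R=\mathbb{C}[x,y,z,s]/(F)$ carries the grading given by the weights above and $(\cdot)_0$ denotes the degree-$0$ part; if the weight $ke_-+d\deg Q$ is not positive, $\mathbb{D}_+(z)$ is understood as this spectrum. The $\mathbb{C}^*$-action on it is the one induced by $\lambda.(x,y,z,s)=(\lambda x,\lambda^{-k}y,z,s)$. *)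

theory Defs
  imports
    "HOL-Analysis.Abstract_Topology"
    "HOL-Algebra.QuotRing"
    "HOL-Algebra.Generated_Rings"
    "HOL-Computational_Algebra.Polynomial"
    "HOL-Computational_Algebra.Fraction_Field"
    "HOL-Library.Poly_Mapping"
begin

definition ring_on :: "'a::comm_ring_1 set \<Rightarrow> 'a ring" where
  "ring_on S = \<lparr>carrier = S, monoid.mult = (*), one = 1, zero = 0, add = (+)\<rparr>"

text \<open>The fraction \<open>a/s\<close> in \<open>S\<inverse>R\<close>, as an equivalence class of pairs.\<close>

definition frac :: "('a, 'm) ring_scheme \<Rightarrow> 'a set \<Rightarrow> 'a \<Rightarrow> 'a \<Rightarrow> ('a \<times> 'a) set" where
  "frac R S a s = {(b, t). b \<in> carrier R \<and> t \<in> S \<and>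
     (\<exists>w\<in>S. w \<otimes>\<^bsub>R\<^esub> (a \<otimes>\<^bsub>R\<^esub> t) = w \<otimes>\<^bsub>R\<^esub> (b \<otimes>\<^bsub>R\<^esub> s))}"

definition localization :: "('a, 'm) ring_scheme \<Rightarrow> 'a set \<Rightarrow> ('a \<times> 'a) set ring" where
  "localization R S =
    \<lparr>carrier = {frac R S a s | a s. a \<in> carrier R \<and> s \<in> S},
     monoid.mult = (\<lambda>x y. \<Union>(a, s)\<in>x. \<Union>(b, t)\<in>y. frac R S (a \<otimes>\<^bsub>R\<^esub> b) (s \<otimes>\<^bsub>R\<^esub> t)),
     one = frac R S \<one>\<^bsub>R\<^esub> \<one>\<^bsub>R\<^esub>,
     zero = frac R S \<zero>\<^bsub>R\<^esub> \<one>\<^bsub>R\<^esub>,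
     add = (\<lambda>x y. \<Union>(a, s)\<in>x. \<Union>(b, t)\<in>y.
              frac R S ((a \<otimes>\<^bsub>R\<^esub> t) \<oplus>\<^bsub>R\<^esub> (b \<otimes>\<^bsub>R\<^esub> s)) (s \<otimes>\<^bsub>R\<^esub> t))\<rparr>"

text \<open>The map \<open>a/s \<mapsto> \<phi>(a)/\<phi>(s)\<close> into \<open>S'\<inverse>R'\<close>, for a ring map \<open>\<phi>\<close> on \<open>R\<close> with
  \<open>\<phi>(S) \<subseteq> S'\<close>. (The source occurs only through the class \<open>x\<close>.)\<close>

definition loc_map ::
  "('b, 'n) ring_scheme \<Rightarrow> 'b set \<Rightarrow> ('a \<Rightarrow> 'b) \<Rightarrow> ('a \<times> 'a) set \<Rightarrow> ('b \<times> 'b) set" where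
  "loc_map R' S' \<phi> x = (\<Union>(a, s)\<in>x. frac R' S' (\<phi> a) (\<phi> s))"

text \<open>A space with a sheaf of complex algebras: \<open>scal U\<close> is the structure map from the complex
  numbers to the sections over \<open>U\<close>, and \<open>restr U V\<close> the restriction from \<open>U\<close> to \<open>V\<close>.
  A complex algebra is always given as a ring together with such a structure map.\<close>

record ('p, 's) cspace =
  under :: "'p topology"
  sect :: "'p set \<Rightarrow> 's ring"
  restr :: "'p set \<Rightarrow> 'p set \<Rightarrow> 's \<Rightarrow> 's"
  scal :: "'p set \<Rightarrow> complex \<Rightarrow> 's"

text \<open>A morphism is a map of points with, for each open \<open>U\<close> of the target, a map from the
  sections over \<open>U\<close> to the sections over the preimage of \<open>U\<close>.\<close>

type_synonym ('p, 's, 'q, 't) cmor = "('p \<Rightarrow> 'q) \<times> ('q set \<Rightarrow> 't \<Rightarrow> 's)"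

definition preim :: "('p, 's) cspace \<Rightarrow> ('p \<Rightarrow> 'q) \<Rightarrow> 'q set \<Rightarrow> 'p set" where
  "preim X f U = {x \<in> topspace (under X). f x \<in> U}"

text \<open>Isomorphisms of locally ringed spaces over the complex numbers: an isomorphism of ringed
  spaces induces isomorphisms of stalks, so locality is automatic.\<close>

definition cspace_iso ::
  "('p, 's) cspace \<Rightarrow> ('q, 't) cspace \<Rightarrow> ('p, 's, 'q, 't) cmor \<Rightarrow> bool" where
  "cspace_iso X Y g \<longleftrightarrow>
     homeomorphic_map (under X) (under Y) (fst g) \<and>
     (\<forall>U. openin (under Y) U \<longrightarrow>
        snd g U \<in> ring_iso (sect Y U) (sect X (preim X (fst g) U)) \<and>
        (\<forall>c. snd g U (scal Y U c) = scal X (preim X (fst g) U) c)) \<and>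
     (\<forall>U V. openin (under Y) U \<and> openin (under Y) V \<and> V \<subseteq> U \<longrightarrow>
        (\<forall>\<sigma>\<in>carrier (sect Y U).
           snd g V (restr Y U V \<sigma>) =
           restr X (preim X (fst g) U) (preim X (fst g) V) (snd g U \<sigma>)))"

text \<open>Equality of the composite morphisms \<open>g \<circ> a\<close> and \<open>b \<circ> g\<close> for \<open>g : X \<rightarrow> Y\<close>,
  \<open>a : X \<rightarrow> X\<close> and \<open>b : Y \<rightarrow> Y\<close>.\<close>

definition intertwines ::
  "('p, 's) cspace \<Rightarrow> ('q, 't) cspace \<Rightarrow> ('p, 's, 'q, 't) cmor \<Rightarrow>
   ('p, 's, 'p, 's) cmor \<Rightarrow> ('q, 't, 'q, 't) cmor \<Rightarrow> bool" where
  "intertwines X Y g a b \<longleftrightarrow>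
     (\<forall>x\<in>topspace (under X). fst g (fst a x) = fst b (fst g x)) \<and>
     (\<forall>U. openin (under Y) U \<longrightarrow> (\<forall>\<sigma>\<in>carrier (sect Y U).
        snd a (preim X (fst g) U) (snd g U \<sigma>) =
        snd g (preim Y (fst b) U) (snd b U \<sigma>)))"

definition equivariantly_isomorphic ::
  "('p, 's) cspace \<Rightarrow> (complex \<Rightarrow> ('p, 's, 'p, 's) cmor) \<Rightarrow>
   ('q, 't) cspace \<Rightarrow> (complex \<Rightarrow> ('q, 't, 'q, 't) cmor) \<Rightarrow> bool" where
  "equivariantly_isomorphic X a Y b \<longleftrightarrow>
     (\<exists>g. cspace_iso X Y g \<and> (\<forall>\<mu>. \<mu> \<noteq> 0 \<longrightarrow> intertwines X Y g (a \<mu>) (b \<mu>)))"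

definition prime_spectrum :: "('a, 'm) ring_scheme \<Rightarrow> 'a set set" where
  "prime_spectrum R = {p. primeideal p R}"

definition zariski :: "('a, 'm) ring_scheme \<Rightarrow> 'a set topology" where
  "zariski R = topology_generated_by ((\<lambda>f. {p \<in> prime_spectrum R. f \<notin> p}) ` carrier R)"

abbreviation stalk :: "('a, 'm) ring_scheme \<Rightarrow> 'a set \<Rightarrow> ('a \<times> 'a) set ring" where
  "stalk R p \<equiv> localization R (carrier R - p)"

definition spec_sections ::
  "('a, 'm) ring_scheme \<Rightarrow> 'a set set \<Rightarrow> ('a set \<Rightarrow> ('a \<times> 'a) set) set" where
  "spec_sections R U = {\<sigma> \<in> (\<Pi>\<^sub>E p\<in>U. carrier (stalk R p)).
     \<forall>p\<in>U. \<exists>V. openin (zariski R) V \<and> p \<in> V \<and> V \<subseteq> U \<and>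
       (\<exists>a\<in>carrier R. \<exists>f\<in>carrier R. \<forall>q\<in>V. f \<notin> q \<and> \<sigma> q = frac R (carrier R - q) a f)}"

definition Spec ::
  "('a, 'm) ring_scheme \<Rightarrow> (complex \<Rightarrow> 'a) \<Rightarrow> ('a set, 'a set \<Rightarrow> ('a \<times> 'a) set) cspace" where
  "Spec R \<iota> =
    \<lparr>under = zariski R,
     sect = (\<lambda>U. \<lparr>carrier = spec_sections R U,
                  monoid.mult = (\<lambda>\<sigma> \<tau>. \<lambda>p\<in>U. \<sigma> p \<otimes>\<^bsub>stalk R p\<^esub> \<tau> p),
                  one = (\<lambda>p\<in>U. \<one>\<^bsub>stalk R p\<^esub>),
                  zero = (\<lambda>p\<in>U. \<zero>\<^bsub>stalk R p\<^esub>),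
                  add = (\<lambda>\<sigma> \<tau>. \<lambda>p\<in>U. \<sigma> p \<oplus>\<^bsub>stalk R p\<^esub> \<tau> p)\<rparr>),
     restr = (\<lambda>U V \<sigma>. restrict \<sigma> V),
     scal = (\<lambda>U c. \<lambda>p\<in>U. frac R (carrier R - p) (\<iota> c) \<one>\<^bsub>R\<^esub>)\<rparr>"

text \<open>The morphism \<open>Spec R' \<rightarrow> Spec R\<close> given by a ring map \<open>\<phi> : R \<rightarrow> R'\<close>.\<close>

definition Spec_map ::
  "('a, 'm) ring_scheme \<Rightarrow> ('b, 'n) ring_scheme \<Rightarrow> ('a \<Rightarrow> 'b) \<Rightarrow>
   ('b set, 'b set \<Rightarrow> ('b \<times> 'b) set, 'a set, 'a set \<Rightarrow> ('a \<times> 'a) set) cmor" where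
  "Spec_map R R' \<phi> =
    (\<lambda>p. {a \<in> carrier R. \<phi> a \<in> p},
     \<lambda>U \<sigma>. \<lambda>p\<in>{p \<in> prime_spectrum R'. {a \<in> carrier R. \<phi> a \<in> p} \<in> U}.
       loc_map R' (carrier R' - p) \<phi> (\<sigma> {a \<in> carrier R. \<phi> a \<in> p}))"

definition algebra_over_C :: "('a, 'm) ring_scheme \<Rightarrow> (complex \<Rightarrow> 'a) \<Rightarrow> bool" where
  "algebra_over_C R \<iota> \<longleftrightarrow> cring R \<and> \<iota> \<in> ring_hom (ring_on (UNIV :: complex set)) R"

definition finite_type :: "('a, 'm) ring_scheme \<Rightarrow> (complex \<Rightarrow> 'a) \<Rightarrow> bool" where
  "finite_type R \<iota> \<longleftrightarrow>
     (\<exists>G. finite G \<and> G \<subseteq> carrier R \<and> generate_ring R (range \<iota> \<union> G) = carrier R)"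

definition integrally_closed :: "('a, 'm) ring_scheme \<Rightarrow> bool" where
  "integrally_closed R \<longleftrightarrow>
    (let S = carrier R - {\<zero>\<^bsub>R\<^esub>}; K = localization R S in
     \<forall>x\<in>carrier K. \<forall>n::nat. \<forall>c\<in>{..<n} \<rightarrow> carrier R.
       n \<ge> 1 \<and>
       x [^]\<^bsub>K\<^esub> n \<oplus>\<^bsub>K\<^esub> (\<Oplus>\<^bsub>K\<^esub>i\<in>{..<n}. frac R S (c i) \<one>\<^bsub>R\<^esub> \<otimes>\<^bsub>K\<^esub> x [^]\<^bsub>K\<^esub> i) = \<zero>\<^bsub>K\<^esub>
       \<longrightarrow> (\<exists>a\<in>carrier R. x = frac R S a \<one>\<^bsub>R\<^esub>))"

definition prime_chain :: "('a, 'm) ring_scheme \<Rightarrow> nat \<Rightarrow> (nat \<Rightarrow> 'a set) \<Rightarrow> bool" where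
  "prime_chain R n p \<longleftrightarrow> (\<forall>i\<le>n. p i \<in> prime_spectrum R) \<and> (\<forall>i<n. p i \<subset> p (Suc i))"

definition has_krull_dim :: "('a, 'm) ring_scheme \<Rightarrow> nat \<Rightarrow> bool" where
  "has_krull_dim R n \<longleftrightarrow> (\<exists>p. prime_chain R n p) \<and> (\<nexists>p. prime_chain R (Suc n) p)"

definition normal_affine_surface :: "('a, 'm) ring_scheme \<Rightarrow> (complex \<Rightarrow> 'a) \<Rightarrow> bool" where
  "normal_affine_surface R \<iota> \<longleftrightarrow>
     algebra_over_C R \<iota> \<and> domain R \<and> finite_type R \<iota> \<and> integrally_closed R \<and> has_krull_dim R 2"

text \<open>A nontrivial algebraic action of the additive group on the spectrum of \<open>R\<close>, through
  the automorphisms it induces on \<open>R\<close>. The last but one condition says that they come from a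
  coaction \<open>R \<rightarrow> R[\<tau>]\<close>, that is, that the action is algebraic.\<close>

definition carries_additive_action :: "('a, 'm) ring_scheme \<Rightarrow> (complex \<Rightarrow> 'a) \<Rightarrow> bool" where
  "carries_additive_action R \<iota> \<longleftrightarrow>
     (\<exists>\<rho> :: complex \<Rightarrow> 'a \<Rightarrow> 'a.
        (\<forall>\<tau>. \<rho> \<tau> \<in> ring_hom R R \<and> (\<forall>c. \<rho> \<tau> (\<iota> c) = \<iota> c)) \<and>
        (\<forall>a\<in>carrier R. \<rho> 0 a = a) \<and>
        (\<forall>\<sigma> \<tau>. \<forall>a\<in>carrier R. \<rho> (\<sigma> + \<tau>) a = \<rho> \<sigma> (\<rho> \<tau> a)) \<and>
        (\<forall>a\<in>carrier R. \<exists>n::nat. \<exists>c\<in>{..n} \<rightarrow> carrier R.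
           \<forall>\<tau>. \<rho> \<tau> a = (\<Oplus>\<^bsub>R\<^esub>i\<in>{..n}. \<iota> (\<tau> ^ i) \<otimes>\<^bsub>R\<^esub> c i)) \<and>
        (\<exists>\<tau>. \<exists>a\<in>carrier R. \<rho> \<tau> a \<noteq> a))"

text \<open>A divisor on the affine line is the function of its coefficients.\<close>

definition is_divisor :: "(complex \<Rightarrow> 'c::zero) \<Rightarrow> bool" where
  "is_divisor D \<longleftrightarrow> finite {c. D c \<noteq> 0}"

definition point_divisor :: "complex \<Rightarrow> complex \<Rightarrow> 'c::zero_neq_one" where
  "point_divisor a = (\<lambda>c. if c = a then 1 else 0)"

definition reduced_divisor :: "(complex \<Rightarrow> int) \<Rightarrow> bool" where
  "reduced_divisor D \<longleftrightarrow> (\<forall>c. D c \<in> {0, 1})"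

text \<open>The divisor of a rational function in \<open>t\<close>; unspecified for the zero function.\<close>

definition div_fract :: "complex poly fract \<Rightarrow> complex \<Rightarrow> int" where
  "div_fract f c = (THE n. \<exists>p q. p \<noteq> 0 \<and> q \<noteq> 0 \<and> f = Fract p q \<and>
     n = int (Polynomial.order c p) - int (Polynomial.order c q))"

text \<open>Laurent polynomials \<open>\<Sum>\<^sub>i f\<^sub>i u\<^sup>i\<close> over the field of rational functions in \<open>t\<close>
  are finitely supported functions \<open>i \<mapsto> f\<^sub>i\<close>, with the convolution product.\<close>

type_synonym laurent = "int \<Rightarrow>\<^sub>0 complex poly fract"

definition DPD_piece ::
  "(complex \<Rightarrow> rat) \<Rightarrow> (complex \<Rightarrow> rat) \<Rightarrow> int \<Rightarrow> complex poly fract set" where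
  "DPD_piece D\<^sub>p D\<^sub>m i = {f. f = 0 \<or> (\<forall>c. of_int (div_fract f c) +
     (if i \<ge> 0 then of_int i * D\<^sub>p c else of_int (- i) * D\<^sub>m c) \<ge> 0)}"

definition DPD_ring :: "(complex \<Rightarrow> rat) \<Rightarrow> (complex \<Rightarrow> rat) \<Rightarrow> laurent ring" where
  "DPD_ring D\<^sub>p D\<^sub>m = ring_on {f. \<forall>i. Poly_Mapping.lookup f i \<in> DPD_piece D\<^sub>p D\<^sub>m i}"

definition DPD_const :: "complex \<Rightarrow> laurent" where
  "DPD_const c = Poly_Mapping.single 0 (Fract [:c:] 1)"

text \<open>The torus element \<open>\<mu>\<close> multiplies functions of degree \<open>i\<close> by \<open>\<mu>\<^sup>i\<close>.\<close>

definition DPD_torus :: "complex \<Rightarrow> laurent \<Rightarrow> laurent" where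
  "DPD_torus \<mu> = Poly_Mapping.mapp (\<lambda>i f. Fract [:\<mu> powi i:] 1 * f)"

definition DPD_Spec where
  "DPD_Spec D\<^sub>p D\<^sub>m = Spec (DPD_ring D\<^sub>p D\<^sub>m) DPD_const"

definition DPD_action where
  "DPD_action D\<^sub>p D\<^sub>m \<mu> =
     Spec_map (DPD_ring D\<^sub>p D\<^sub>m) (DPD_ring D\<^sub>p D\<^sub>m) (DPD_torus \<mu>)"

datatype var = X | Y | Z | S

text \<open>Polynomials in \<open>x, y, z, s\<close>, as finitely supported functions on monomials.\<close>

type_synonym mpoly4 = "(var \<Rightarrow>\<^sub>0 nat) \<Rightarrow>\<^sub>0 complex"

definition Var :: "var \<Rightarrow> mpoly4" where
  "Var v = Poly_Mapping.single (Poly_Mapping.single v 1) 1"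

definition Const :: "complex \<Rightarrow> mpoly4" where
  "Const c = Poly_Mapping.single 0 c"

definition weighted_degree :: "(var \<Rightarrow> int) \<Rightarrow> (var \<Rightarrow>\<^sub>0 nat) \<Rightarrow> int" where
  "weighted_degree w m = (\<Sum>v\<in>Poly_Mapping.keys m. w v * int (Poly_Mapping.lookup m v))"

definition weighted_homogeneous :: "(var \<Rightarrow> int) \<Rightarrow> int \<Rightarrow> mpoly4 \<Rightarrow> bool" where
  "weighted_homogeneous w n p \<longleftrightarrow> (\<forall>m\<in>Poly_Mapping.keys p. weighted_degree w m = n)"

text \<open>The substitution \<open>v \<mapsto> \<mu>\<^bsup>w v\<^esup> v\<close> of the variables \<open>v\<close>.\<close>

definition torus_subst :: "(var \<Rightarrow> int) \<Rightarrow> complex \<Rightarrow> mpoly4 \<Rightarrow> mpoly4" where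
  "torus_subst w \<mu> = Poly_Mapping.mapp (\<lambda>m a. \<mu> powi weighted_degree w m * a)"

definition hyp_weight :: "int \<Rightarrow> int \<Rightarrow> nat \<Rightarrow> nat \<Rightarrow> complex poly \<Rightarrow> var \<Rightarrow> int" where
  "hyp_weight e\<^sub>p e\<^sub>m d k Q v =
    (case v of X \<Rightarrow> e\<^sub>p | Y \<Rightarrow> int k * e\<^sub>m + int d * int (degree Q) | Z \<Rightarrow> int d | S \<Rightarrow> 1)"

definition hyp_character :: "nat \<Rightarrow> var \<Rightarrow> int" where
  "hyp_character k v = (case v of X \<Rightarrow> 1 | Y \<Rightarrow> - int k | Z \<Rightarrow> 0 | S \<Rightarrow> 0)"

text \<open>The sum is \<open>Q(s\<^sup>d/z) z\<^bsup>deg Q\<^esup>\<close>. Pitfall: \<open>nat\<close> truncates, so this is the intended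
  polynomial only for \<open>e\<^sub>p + e\<^sub>m \<ge> 0\<close>.\<close>

definition hyp_poly :: "int \<Rightarrow> int \<Rightarrow> nat \<Rightarrow> nat \<Rightarrow> complex poly \<Rightarrow> mpoly4" where
  "hyp_poly e\<^sub>p e\<^sub>m d k Q =
     Var X ^ k * Var Y - Var S ^ nat (int k * (e\<^sub>p + e\<^sub>m)) *
       (\<Sum>i\<le>degree Q. Const (coeff Q i) * (Var S ^ d) ^ i * Var Z ^ (degree Q - i))"

context
  fixes F :: mpoly4
begin

definition hyp_ideal :: "mpoly4 set" where
  "hyp_ideal = PIdl\<^bsub>ring_on UNIV\<^esub> F"

definition hyp_ring :: "mpoly4 set ring" where
  "hyp_ring = ring_on UNIV Quot hyp_ideal"

definition hyp_class :: "mpoly4 \<Rightarrow> mpoly4 set" where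
  "hyp_class p = hyp_ideal +>\<^bsub>ring_on UNIV\<^esub> p"

definition z_powers :: "mpoly4 set set" where
  "z_powers = range (\<lambda>n. hyp_class (Var Z ^ n))"

text \<open>The degree zero part of \<open>R[1/z]\<close>, for \<open>R\<close> the quotient by \<open>F\<close>: the fractions \<open>p/z\<^sup>n\<close>
  with \<open>p\<close> homogeneous of degree \<open>n deg z\<close>.\<close>

definition chart_ring :: "(var \<Rightarrow> int) \<Rightarrow> (mpoly4 set \<times> mpoly4 set) set ring" where
  "chart_ring w = (localization hyp_ring z_powers)
     \<lparr>carrier := {frac hyp_ring z_powers (hyp_class p) (hyp_class (Var Z ^ n)) | p n.
        weighted_homogeneous w (int n * w Z) p}\<rparr>"

definition chart_const :: "complex \<Rightarrow> (mpoly4 set \<times> mpoly4 set) set" where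
  "chart_const c = frac hyp_ring z_powers (hyp_class (Const c)) \<one>\<^bsub>hyp_ring\<^esub>"

text \<open>The automorphism of \<open>R[1/z]\<close> induced by \<open>torus_subst \<chi> \<mu>\<close>, for \<open>\<mu> \<noteq> 0\<close>, when \<open>F\<close> is
  homogeneous for \<open>\<chi>\<close> and \<open>\<chi> Z = 0\<close>: the substitution then preserves the ideal of \<open>F\<close>, and maps
  the coset of \<open>p\<close> onto the coset of the image of \<open>p\<close>.\<close>

definition chart_torus ::
  "(var \<Rightarrow> int) \<Rightarrow> complex \<Rightarrow>
   (mpoly4 set \<times> mpoly4 set) set \<Rightarrow> (mpoly4 set \<times> mpoly4 set) set" where
  "chart_torus \<chi> \<mu> = loc_map hyp_ring z_powers ((`) (torus_subst \<chi> \<mu>))"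

definition D_plus_z where
  "D_plus_z w = Spec (chart_ring w) chart_const"

definition D_plus_z_action where
  "D_plus_z_action w \<chi> \<mu> = Spec_map (chart_ring w) (chart_ring w) (chart_torus \<chi> \<mu>)"

end

end

(* Substituting s = 1, z = 1/t, x = u, y = Q t^(-deg Q) u^(-k) kills F, and sends a fraction p/z^n
   with p weighted homogeneous of degree n d to the Laurent polynomial t^n p(u, Q t^(-deg Q) u^(-k), 1/t, 1).
   Modulo F every weighted homogeneous p is a combination of monomials x^a y^b z^e s^c with a < k or
   b = 0. On these the u-degree a - k b determines a and b, and e then determines c, so the images
   are linearly independent, and the map is injective on the degree zero part of R[1/z]. Its image in
   u-degree i is spanned by the t^m Q^b u^i with d m >= a e_+ + k b e_-, where a - k b = i. Since k = 1,
   or e_+ + e_- = 0 and Q has simple roots, these span the graded piece A_i, so the degree zero part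
   of R[1/z] is equivariantly isomorphic to A; this isomorphism is transported to spectra. *)
theory Submission
  imports
    Defs
    "HOL-Computational_Algebra.Fundamental_Theorem_Algebra"
begin

section \<open>Spectra of isomorphic rings\<close>

text \<open>The delicate point is surjectivity in the degrees \<open>-N < 0\<close>, and it explains
  conditions (i) and (ii). The graded piece asks for order at least \<open>N e\<^sub>m / d\<close>
  at 0 and at least \<open>N D\<^sub>0 / k\<close> at the roots of \<open>Q\<close>. A product
  \<open>x^a y^b\<close> with \<open>k b - a = N\<close> only reaches orders from
  \<open>(a e\<^sub>p + k b e\<^sub>m) / d\<close> at 0 and \<open>b D\<^sub>0\<close> at the roots;
  the smallest possible \<open>b\<close> is \<open>N/k\<close> rounded up. The excess at 0 is
  \<open>a (e\<^sub>p + e\<^sub>m) / d\<close>; at the roots, \<open>D\<^sub>0\<close> times the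
  rounded \<open>N/k\<close> stands against the rounded \<open>N D\<^sub>0 / k\<close>. Under (i),
  \<open>a = 0\<close> and nothing is rounded. Under (ii), the excess at 0 vanishes, and rounding
  commutes with the factor \<open>D\<^sub>0\<close>, which is 0 or 1. The ring laws of
  \<open>A\<close> come from the assumption that \<open>V\<close> is a normal affine surface. Those
  of the chart are transported along the isomorphism, which is therefore built in the direction from
  \<open>A\<close> to the chart.\<close>

lemma topspace_zariski:
  assumes "ring R"
  shows "topspace (zariski R) = prime_spectrum R"
proof -
  have "\<one>\<^bsub>R\<^esub> \<in> carrier R" using assms by (rule ring.ring_simprules)
  moreover have "\<one>\<^bsub>R\<^esub> \<notin> p" if "p \<in> prime_spectrum R" for p
    using that ideal.one_imp_carrier[of p R] primeideal.I_notcarr[of p R] primeideal.axioms(1)[of p R]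
    by (auto simp: prime_spectrum_def)
  ultimately show ?thesis unfolding zariski_def topology_generated_by_topspace by auto
qed

lemma prime_spectrum_carrier: "p \<in> prime_spectrum R \<Longrightarrow> p \<subseteq> carrier R"
  unfolding prime_spectrum_def
  by (auto dest: primeideal.axioms(1) ideal.axioms(1) additive_subgroup.a_subset)

lemma stalk_carrierD:
  assumes "x \<in> carrier (stalk R p)" "(a, s) \<in> x"
  shows "a \<in> carrier R" "s \<in> carrier R"
  using assms by (auto simp: localization_def frac_def)

text \<open>The inverse \<open>j\<close> is a parameter, so that \<open>sym\<close> exchanges the
  two rings and every fact proved for \<open>h\<close> is available for \<open>j\<close> as
  well.\<close>

locale ring_isomorphism = R: cring R + R': cring R'
  for R :: "('a, 'm) ring_scheme" and R' :: "('b, 'n) ring_scheme" +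
  fixes h :: "'a \<Rightarrow> 'b" and j :: "'b \<Rightarrow> 'a"
  assumes h_hom: "h \<in> ring_hom R R'" and j_hom: "j \<in> ring_hom R' R"
    and j_h: "a \<in> carrier R \<Longrightarrow> j (h a) = a" and h_j: "b \<in> carrier R' \<Longrightarrow> h (j b) = b"
begin

lemma sym: "ring_isomorphism R' R j h"
  by unfold_locales (auto simp: h_hom j_hom j_h h_j)

lemma h_closed: "a \<in> carrier R \<Longrightarrow> h a \<in> carrier R'"
  and h_mult: "a \<in> carrier R \<Longrightarrow> b \<in> carrier R \<Longrightarrow> h (a \<otimes>\<^bsub>R\<^esub> b) = h a \<otimes>\<^bsub>R'\<^esub> h b"
  and h_add: "a \<in> carrier R \<Longrightarrow> b \<in> carrier R \<Longrightarrow> h (a \<oplus>\<^bsub>R\<^esub> b) = h a \<oplus>\<^bsub>R'\<^esub> h b"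
  and h_one: "h \<one>\<^bsub>R\<^esub> = \<one>\<^bsub>R'\<^esub>"
  using h_hom by (auto simp: ring_hom_def)

lemma h_zero: "h \<zero>\<^bsub>R\<^esub> = \<zero>\<^bsub>R'\<^esub>"
  using ring_hom_zero[OF h_hom R.ring_axioms R'.ring_axioms] .

lemma j_closed: "b \<in> carrier R' \<Longrightarrow> j b \<in> carrier R"
  using j_hom by (auto simp: ring_hom_def)

text \<open>Turns a direct image into a preimage along \<open>j\<close>; images of primes are then
  prime as contractions of primes.\<close>

lemma h_image_vimage:
  assumes "p \<subseteq> carrier R"
  shows "h ` p = {b \<in> carrier R'. j b \<in> p}"
  using assms by (force simp: j_h h_closed h_j intro!: image_eqI[of _ h "j _"])

lemma h_mem_image_iff:
  assumes "p \<subseteq> carrier R" "a \<in> carrier R"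
  shows "h a \<in> h ` p \<longleftrightarrow> a \<in> p"
  using assms by (auto simp: h_image_vimage j_h h_closed)

lemma j_image_h_image: "p \<subseteq> carrier R \<Longrightarrow> j ` h ` p = p"
  by (force simp: j_h image_iff)

lemma h_image_compl: "p \<subseteq> carrier R \<Longrightarrow> h ` (carrier R - p) = carrier R' - h ` p"
  by (auto simp: h_image_vimage j_h h_closed h_j j_closed)

lemma prime_image:
  assumes "p \<in> prime_spectrum R"
  shows "h ` p \<in> prime_spectrum R'"
proof -
  interpret ring_hom_ring R' R j
    by (rule ring_hom_ringI2[OF R'.ring_axioms R.ring_axioms j_hom])
  show ?thesis
    using primeideal_vimage[OF R'.cring_axioms, of p] assms prime_spectrum_carrier[OF assms]
    by (simp add: prime_spectrum_def h_image_vimage)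
qed

text \<open>A fraction is a class of pairs, so it is transported by applying \<open>h\<close> to
  every pair in it. For the reverse inclusion the defining equation is pulled back by injectivity of
  \<open>h\<close>.\<close>

lemma image_frac:
  assumes "a \<in> carrier R" "s \<in> carrier R" "T \<subseteq> carrier R"
  shows "map_prod h h ` frac R T a s = frac R' (h ` T) (h a) (h s)"
proof (intro subset_antisym subsetI)
  fix x assume "x \<in> map_prod h h ` frac R T a s"
  then obtain b t w where x: "x = (h b, h t)" "b \<in> carrier R" "t \<in> T" "w \<in> T"
    and eq: "w \<otimes>\<^bsub>R\<^esub> (a \<otimes>\<^bsub>R\<^esub> t) = w \<otimes>\<^bsub>R\<^esub> (b \<otimes>\<^bsub>R\<^esub> s)"
    by (auto simp: frac_def)
  have "w \<in> carrier R" "t \<in> carrier R" using x assms by auto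
  then have "h w \<otimes>\<^bsub>R'\<^esub> (h a \<otimes>\<^bsub>R'\<^esub> h t) = h w \<otimes>\<^bsub>R'\<^esub> (h b \<otimes>\<^bsub>R'\<^esub> h s)"
    using arg_cong[OF eq, of h] assms x by (simp add: h_mult)
  then show "x \<in> frac R' (h ` T) (h a) (h s)"
    using x by (auto simp: frac_def h_closed)
next
  fix x assume "x \<in> frac R' (h ` T) (h a) (h s)"
  then obtain b t w where x: "x = (b, h t)" "b \<in> carrier R'" "t \<in> T" "w \<in> T"
    and eq: "h w \<otimes>\<^bsub>R'\<^esub> (h a \<otimes>\<^bsub>R'\<^esub> h t) = h w \<otimes>\<^bsub>R'\<^esub> (b \<otimes>\<^bsub>R'\<^esub> h s)"
    by (auto simp: frac_def)
  have c: "w \<in> carrier R" "t \<in> carrier R" "j b \<in> carrier R" using x assms by (auto simp: j_closed)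
  have "h (w \<otimes>\<^bsub>R\<^esub> (a \<otimes>\<^bsub>R\<^esub> t)) = h (w \<otimes>\<^bsub>R\<^esub> (j b \<otimes>\<^bsub>R\<^esub> s))"
    using eq c assms x by (simp add: h_mult h_j)
  then have "w \<otimes>\<^bsub>R\<^esub> (a \<otimes>\<^bsub>R\<^esub> t) = w \<otimes>\<^bsub>R\<^esub> (j b \<otimes>\<^bsub>R\<^esub> s)"
    using c assms by (metis R.m_closed j_h)
  then have "(j b, t) \<in> frac R T a s" using c x by (auto simp: frac_def)
  then show "x \<in> map_prod h h ` frac R T a s" using x by (force simp: h_j)
qed

text \<open>Sum and product of classes are unions over all representatives, and direct images
  commute with unions. Compatibility is thus checked pair by pair, without well-definedness of the
  operations.\<close>

lemma image_stalk:
  assumes "p \<subseteq> carrier R"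
  shows "a \<in> carrier R \<Longrightarrow> s \<in> carrier R \<Longrightarrow>
      map_prod h h ` frac R (carrier R - p) a s = frac R' (carrier R' - h ` p) (h a) (h s)"
    and "x \<in> carrier (stalk R p) \<Longrightarrow> map_prod h h ` x \<in> carrier (stalk R' (h ` p))"
    and "x \<in> carrier (stalk R p) \<Longrightarrow> y \<in> carrier (stalk R p) \<Longrightarrow>
      map_prod h h ` (x \<otimes>\<^bsub>stalk R p\<^esub> y) = map_prod h h ` x \<otimes>\<^bsub>stalk R' (h ` p)\<^esub> map_prod h h ` y"
    and "x \<in> carrier (stalk R p) \<Longrightarrow> y \<in> carrier (stalk R p) \<Longrightarrow>
      map_prod h h ` (x \<oplus>\<^bsub>stalk R p\<^esub> y) = map_prod h h ` x \<oplus>\<^bsub>stalk R' (h ` p)\<^esub> map_prod h h ` y"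
    and "map_prod h h ` \<one>\<^bsub>stalk R p\<^esub> = \<one>\<^bsub>stalk R' (h ` p)\<^esub>"
    and "map_prod h h ` \<zero>\<^bsub>stalk R p\<^esub> = \<zero>\<^bsub>stalk R' (h ` p)\<^esub>"
proof -
  have fr: "map_prod h h ` frac R (carrier R - p) a s = frac R' (carrier R' - h ` p) (h a) (h s)"
    if "a \<in> carrier R" "s \<in> carrier R" for a s
    using image_frac[OF that, of "carrier R - p"] h_image_compl[OF assms] by auto
  then show "a \<in> carrier R \<Longrightarrow> s \<in> carrier R \<Longrightarrow>
      map_prod h h ` frac R (carrier R - p) a s = frac R' (carrier R' - h ` p) (h a) (h s)" .
  show "x \<in> carrier (stalk R p) \<Longrightarrow> map_prod h h ` x \<in> carrier (stalk R' (h ` p))"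
  proof -
    assume "x \<in> carrier (stalk R p)"
    then obtain a s where x: "x = frac R (carrier R - p) a s" "a \<in> carrier R" "s \<in> carrier R - p"
      by (auto simp: localization_def)
    then have "h a \<in> carrier R'" "h s \<in> carrier R' - h ` p"
      by (auto simp: h_closed h_mem_image_iff[OF assms])
    then show ?thesis using x by (auto simp: localization_def fr)
  qed
  have cD: "fst u \<in> carrier R" "snd u \<in> carrier R" if "x \<in> carrier (stalk R p)" "u \<in> x" for x u
    using stalk_carrierD[OF that(1), of "fst u" "snd u"] that(2) by auto
  show "map_prod h h ` (x \<otimes>\<^bsub>stalk R p\<^esub> y) = map_prod h h ` x \<otimes>\<^bsub>stalk R' (h ` p)\<^esub> map_prod h h ` y"
    if "x \<in> carrier (stalk R p)" "y \<in> carrier (stalk R p)"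
  proof -
    have "map_prod h h ` (x \<otimes>\<^bsub>stalk R p\<^esub> y) =
      (\<Union>u\<in>x. \<Union>v\<in>y. map_prod h h ` frac R (carrier R - p) (fst u \<otimes>\<^bsub>R\<^esub> fst v) (snd u \<otimes>\<^bsub>R\<^esub> snd v))"
      by (simp add: localization_def image_UN split_beta)
    also have "\<dots> = (\<Union>u\<in>x. \<Union>v\<in>y. frac R' (carrier R' - h ` p)
        (h (fst u) \<otimes>\<^bsub>R'\<^esub> h (fst v)) (h (snd u) \<otimes>\<^bsub>R'\<^esub> h (snd v)))"
      using cD[OF that(1)] cD[OF that(2)] by (intro SUP_cong refl) (simp add: fr h_mult)
    finally show ?thesis by (simp add: localization_def split_beta)
  qed
  show "map_prod h h ` (x \<oplus>\<^bsub>stalk R p\<^esub> y) = map_prod h h ` x \<oplus>\<^bsub>stalk R' (h ` p)\<^esub> map_prod h h ` y"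
    if "x \<in> carrier (stalk R p)" "y \<in> carrier (stalk R p)"
  proof -
    have "map_prod h h ` (x \<oplus>\<^bsub>stalk R p\<^esub> y) =
      (\<Union>u\<in>x. \<Union>v\<in>y. map_prod h h ` frac R (carrier R - p)
        ((fst u \<otimes>\<^bsub>R\<^esub> snd v) \<oplus>\<^bsub>R\<^esub> (fst v \<otimes>\<^bsub>R\<^esub> snd u)) (snd u \<otimes>\<^bsub>R\<^esub> snd v))"
      by (simp add: localization_def image_UN split_beta)
    also have "\<dots> = (\<Union>u\<in>x. \<Union>v\<in>y. frac R' (carrier R' - h ` p)
        ((h (fst u) \<otimes>\<^bsub>R'\<^esub> h (snd v)) \<oplus>\<^bsub>R'\<^esub> (h (fst v) \<otimes>\<^bsub>R'\<^esub> h (snd u)))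
        (h (snd u) \<otimes>\<^bsub>R'\<^esub> h (snd v)))"
      using cD[OF that(1)] cD[OF that(2)] by (intro SUP_cong refl) (simp add: fr h_mult h_add)
    finally show ?thesis by (simp add: localization_def split_beta)
  qed
  show "map_prod h h ` \<one>\<^bsub>stalk R p\<^esub> = \<one>\<^bsub>stalk R' (h ` p)\<^esub>"
    by (simp add: localization_def fr h_one)
  show "map_prod h h ` \<zero>\<^bsub>stalk R p\<^esub> = \<zero>\<^bsub>stalk R' (h ` p)\<^esub>"
    by (simp add: localization_def fr h_one h_zero)
qed

text \<open>The preimage of the basic open set of \<open>f\<close> is the basic open set of
  \<open>j f\<close>.\<close>

lemma continuous_image: "continuous_map (zariski R) (zariski R') ((`) h)"
  unfolding zariski_def[of R']
proof (rule continuous_on_generated_topo)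
  fix U assume "U \<in> (\<lambda>f. {p \<in> prime_spectrum R'. f \<notin> p}) ` carrier R'"
  then obtain f where f: "f \<in> carrier R'" and U: "U = {p \<in> prime_spectrum R'. f \<notin> p}" by auto
  have "(`) h -` U \<inter> topspace (zariski R) = {p \<in> prime_spectrum R. j f \<notin> p}"
  proof -
    have "f \<in> h ` p \<longleftrightarrow> j f \<in> p" if "p \<in> prime_spectrum R" for p
      using f by (simp add: h_image_vimage[OF prime_spectrum_carrier[OF that]])
    then have "p \<in> (`) h -` U \<inter> prime_spectrum R \<longleftrightarrow> p \<in> {p \<in> prime_spectrum R. j f \<notin> p}" for p
      using prime_image[of p] by (cases "p \<in> prime_spectrum R") (simp_all add: U)
    then show ?thesis unfolding topspace_zariski[OF R.ring_axioms] by blast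
  qed
  also have "openin (zariski R) \<dots>"
    unfolding zariski_def using f by (intro topology_generated_by_Basis) (auto simp: j_closed)
  finally show "openin (zariski R) ((`) h -` U \<inter> topspace (zariski R))" .
next
  have eq: "\<Union>((\<lambda>f. {p \<in> prime_spectrum R'. f \<notin> p}) ` carrier R') = prime_spectrum R'"
    using topspace_zariski[OF R'.ring_axioms] unfolding zariski_def topology_generated_by_topspace .
  show "(`) h ` topspace (zariski R) \<subseteq> \<Union>((\<lambda>f. {p \<in> prime_spectrum R'. f \<notin> p}) ` carrier R')"
    unfolding eq topspace_zariski[OF R.ring_axioms] using prime_image by blast
qed

interpretation inv: ring_isomorphism R' R j h by (rule sym)

lemma homeomorphic_image: "homeomorphic_map (zariski R) (zariski R') ((`) h)"
proof -
  have "homeomorphic_maps (zariski R) (zariski R') ((`) h) ((`) j)"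
    unfolding homeomorphic_maps_def
    using continuous_image inv.continuous_image
    by (auto simp: topspace_zariski R.ring_axioms R'.ring_axioms
        j_image_h_image[OF prime_spectrum_carrier] inv.j_image_h_image[OF prime_spectrum_carrier])
  then show ?thesis by (rule homeomorphic_maps_imp_map)
qed

lemma preim_Spec: "preim (Spec R \<iota>) ((`) h) U = {p \<in> prime_spectrum R. h ` p \<in> U}"
  by (simp add: preim_def Spec_def topspace_zariski R.ring_axioms)

lemma map_prod_image_inverse:
  "x \<in> carrier (stalk R p) \<Longrightarrow> map_prod j j ` map_prod h h ` x = x"
proof -
  assume x: "x \<in> carrier (stalk R p)"
  have "(map_prod j j \<circ> map_prod h h) u = u" if "u \<in> x" for u
    using stalk_carrierD[OF x, of "fst u" "snd u"] that by (cases u) (auto simp: j_h)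
  then show ?thesis unfolding image_comp by simp
qed

end

section \<open>Transport of sections of the structure sheaf\<close>

definition pull_sections ::
  "('a \<Rightarrow> 'b) \<Rightarrow> ('b \<Rightarrow> 'a) \<Rightarrow> ('a, 'm) ring_scheme \<Rightarrow> 'b set set \<Rightarrow>
   ('b set \<Rightarrow> ('b \<times> 'b) set) \<Rightarrow> 'a set \<Rightarrow> ('a \<times> 'a) set" where
  "pull_sections h j R U \<sigma> = (\<lambda>p\<in>{p \<in> prime_spectrum R. h ` p \<in> U}. map_prod j j ` \<sigma> (h ` p))"

context ring_isomorphism
begin

interpretation inv: ring_isomorphism R' R j h by (rule sym)

lemma openin_preim:
  assumes "openin (zariski R') U"
  shows "openin (zariski R) {p \<in> prime_spectrum R. h ` p \<in> U}"
  using openin_continuous_map_preimage[OF continuous_image assms]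
  by (simp add: topspace_zariski R.ring_axioms)

text \<open>A section equal to \<open>a/f\<close> on \<open>V\<close> becomes
  \<open>j a / j f\<close> on the preimage of \<open>V\<close>.\<close>

lemma pull_sections_closed:
  assumes U: "openin (zariski R') U" and \<sigma>: "\<sigma> \<in> spec_sections R' U"
  shows "pull_sections h j R U \<sigma> \<in> spec_sections R {p \<in> prime_spectrum R. h ` p \<in> U}"
proof -
  let ?W = "{p \<in> prime_spectrum R. h ` p \<in> U}"
  have st: "\<sigma> q \<in> carrier (stalk R' q)" if "q \<in> U" for q
    using \<sigma> that by (auto simp: spec_sections_def)
  have "pull_sections h j R U \<sigma> \<in> (\<Pi>\<^sub>E p\<in>?W. carrier (stalk R p))"
  proof (unfold pull_sections_def, rule restrict_PiE_iff[THEN iffD2], intro ballI)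
    fix p assume p: "p \<in> ?W"
    then have pc: "p \<subseteq> carrier R" "h ` p \<subseteq> carrier R'"
      using prime_spectrum_carrier h_closed by auto
    show "map_prod j j ` \<sigma> (h ` p) \<in> carrier (stalk R p)"
      using inv.image_stalk(2)[OF pc(2) st] p j_image_h_image[OF pc(1)] by simp
  qed
  moreover have "\<exists>V. openin (zariski R) V \<and> p \<in> V \<and> V \<subseteq> ?W \<and>
       (\<exists>a\<in>carrier R. \<exists>f\<in>carrier R. \<forall>q\<in>V. f \<notin> q \<and>
          pull_sections h j R U \<sigma> q = frac R (carrier R - q) a f)"
    if p: "p \<in> ?W" for p
  proof -
    have "\<exists>V. openin (zariski R') V \<and> h ` p \<in> V \<and> V \<subseteq> U \<and>
       (\<exists>a\<in>carrier R'. \<exists>f\<in>carrier R'. \<forall>q\<in>V. f \<notin> q \<and> \<sigma> q = frac R' (carrier R' - q) a f)"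
      using \<sigma> p by (simp add: spec_sections_def)
    then obtain V a f where V: "openin (zariski R') V" "h ` p \<in> V" "V \<subseteq> U"
      and af: "a \<in> carrier R'" "f \<in> carrier R'"
      and eq: "\<forall>q\<in>V. f \<notin> q \<and> \<sigma> q = frac R' (carrier R' - q) a f"
      by (elim exE conjE bexE)
    have "j f \<notin> q \<and> pull_sections h j R U \<sigma> q = frac R (carrier R - q) (j a) (j f)"
      if q: "q \<in> prime_spectrum R" "h ` q \<in> V" for q
    proof -
      have qc: "q \<subseteq> carrier R" "h ` q \<subseteq> carrier R'"
        using q prime_spectrum_carrier h_closed by auto
      have "pull_sections h j R U \<sigma> q = map_prod j j ` frac R' (carrier R' - h ` q) a f"
        using q V bspec[OF eq q(2)] by (auto simp: pull_sections_def)
      also have "\<dots> = frac R (carrier R - q) (j a) (j f)"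
        using inv.image_stalk(1)[OF qc(2) af] j_image_h_image[OF qc(1)] by simp
      finally show ?thesis using bspec[OF eq q(2)] af qc by (auto simp: h_image_vimage)
    qed
    moreover have "j a \<in> carrier R" "j f \<in> carrier R" using af by (auto simp: j_closed)
    ultimately show ?thesis
      using V p openin_preim[OF V(1)]
      by (intro exI[of _ "{p \<in> prime_spectrum R. h ` p \<in> V}"]) blast
  qed
  ultimately show ?thesis unfolding spec_sections_def by blast
qed

text \<open>The domain is part of a section, so pulling back along \<open>h\<close> and then along
  \<open>j\<close> has to return to literally the same open set.\<close>

lemma vimage_preim:
  assumes "U \<subseteq> prime_spectrum R'"
  shows "{q \<in> prime_spectrum R'. j ` q \<in> {p \<in> prime_spectrum R. h ` p \<in> U}} = U"
proof -
  have "h ` j ` q = q" "j ` q \<in> prime_spectrum R" if "q \<in> prime_spectrum R'" for q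
    using that inv.prime_image inv.j_image_h_image[OF prime_spectrum_carrier] by auto
  then show ?thesis using assms by fastforce
qed

lemma pull_sections_inverse:
  assumes U: "U \<subseteq> prime_spectrum R'" and \<sigma>: "\<sigma> \<in> spec_sections R' U"
  shows "pull_sections j h R' {p \<in> prime_spectrum R. h ` p \<in> U} (pull_sections h j R U \<sigma>) = \<sigma>"
proof
  fix q
  have dom: "{q \<in> prime_spectrum R'. j ` q \<in> {p \<in> prime_spectrum R. h ` p \<in> U}} = U"
    by (rule vimage_preim[OF U])
  show "pull_sections j h R' {p \<in> prime_spectrum R. h ` p \<in> U} (pull_sections h j R U \<sigma>) q = \<sigma> q"
  proof (cases "q \<in> U")
    case True
    then have "\<sigma> q \<in> carrier (stalk R' q)" using \<sigma> by (auto simp: spec_sections_def)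
    moreover have "q \<in> prime_spectrum R'" using True U by auto
    then have "h ` j ` q = q" "j ` q \<in> prime_spectrum R"
      by (simp_all only: inv.j_image_h_image[OF prime_spectrum_carrier] inv.prime_image)
    ultimately show ?thesis
      using True unfolding pull_sections_def dom by (simp add: inv.map_prod_image_inverse)
  next
    case False
    then have "\<sigma> q = undefined" using \<sigma> by (auto simp: spec_sections_def PiE_def extensional_def)
    then show ?thesis using False unfolding pull_sections_def dom by simp
  qed
qed

lemma pull_sections_iso:
  assumes U: "openin (zariski R') U"
  shows "pull_sections h j R U \<in>
    ring_iso (sect (Spec R' \<iota>') U) (sect (Spec R \<iota>) {p \<in> prime_spectrum R. h ` p \<in> U})"
proof -
  let ?W = "{p \<in> prime_spectrum R. h ` p \<in> U}"
  have Us: "U \<subseteq> prime_spectrum R'"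
    using openin_subset[OF U] by (simp add: topspace_zariski R'.ring_axioms)
  have WU: "{q \<in> prime_spectrum R'. j ` q \<in> ?W} = U"
    by (rule vimage_preim[OF Us])
  have W: "openin (zariski R) ?W" by (rule openin_preim[OF U])
  have st: "\<sigma> (h ` p) \<in> carrier (stalk R' (h ` p))" if "\<sigma> \<in> spec_sections R' U" "p \<in> ?W" for \<sigma> p
    using that by (auto simp: spec_sections_def)
  have pc: "h ` p \<subseteq> carrier R'" "j ` h ` p = p" if "p \<in> ?W" for p
    using that prime_spectrum_carrier[of p R] h_closed j_image_h_image[of p] by auto
  have "bij_betw (pull_sections h j R U) (spec_sections R' U) (spec_sections R ?W)"
  proof (rule bij_betwI[where g = "pull_sections j h R' ?W"])
    show "pull_sections h j R U \<in> spec_sections R' U \<rightarrow> spec_sections R ?W"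
      using pull_sections_closed[OF U] by auto
    show "pull_sections j h R' ?W \<in> spec_sections R ?W \<rightarrow> spec_sections R' U"
      using ring_isomorphism.pull_sections_closed[OF sym W] unfolding WU by auto
    show "pull_sections j h R' ?W (pull_sections h j R U \<sigma>) = \<sigma>" if "\<sigma> \<in> spec_sections R' U" for \<sigma>
      using pull_sections_inverse[OF Us that] .
    show "pull_sections h j R U (pull_sections j h R' ?W \<tau>) = \<tau>" if "\<tau> \<in> spec_sections R ?W" for \<tau>
      using ring_isomorphism.pull_sections_inverse[OF sym, of ?W \<tau>] that unfolding WU by auto
  qed
  moreover have "map_prod j j ` (\<sigma> (h ` p) \<otimes>\<^bsub>stalk R' (h ` p)\<^esub> \<tau> (h ` p)) =
        map_prod j j ` \<sigma> (h ` p) \<otimes>\<^bsub>stalk R p\<^esub> map_prod j j ` \<tau> (h ` p)"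
      "map_prod j j ` (\<sigma> (h ` p) \<oplus>\<^bsub>stalk R' (h ` p)\<^esub> \<tau> (h ` p)) =
        map_prod j j ` \<sigma> (h ` p) \<oplus>\<^bsub>stalk R p\<^esub> map_prod j j ` \<tau> (h ` p)"
    if "\<sigma> \<in> spec_sections R' U" "\<tau> \<in> spec_sections R' U" "p \<in> ?W" for \<sigma> \<tau> p
    using inv.image_stalk(3,4)[OF pc(1) st st] pc(2) that by simp_all
  moreover have "map_prod j j ` \<one>\<^bsub>stalk R' (h ` p)\<^esub> = \<one>\<^bsub>stalk R p\<^esub>" if "p \<in> ?W" for p
    using inv.image_stalk(5)[OF pc(1)] pc(2) that by simp
  moreover note pull_sections_closed[OF U]
  ultimately show ?thesis
    by (intro ring_iso_memI) (simp_all add: Spec_def, simp_all add: pull_sections_def fun_eq_iff restrict_def)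
qed

lemma Spec_iso:
  assumes \<iota>: "\<And>c. \<iota> c \<in> carrier R" "\<And>c. h (\<iota> c) = \<iota>' c"
  shows "cspace_iso (Spec R \<iota>) (Spec R' \<iota>') ((`) h, pull_sections h j R)"
proof -
  have under: "under (Spec R \<iota>) = zariski R" "under (Spec R' \<iota>') = zariski R'"
    by (simp_all add: Spec_def)
  have sc: "pull_sections h j R U (scal (Spec R' \<iota>') U c) =
      scal (Spec R \<iota>) {p \<in> prime_spectrum R. h ` p \<in> U} c" for U c
  proof -
    have "map_prod j j ` frac R' (carrier R' - h ` p) (\<iota>' c) \<one>\<^bsub>R'\<^esub> =
        frac R (carrier R - p) (\<iota> c) \<one>\<^bsub>R\<^esub>" if "p \<in> prime_spectrum R" for p
    proof -
      have pc: "p \<subseteq> carrier R" "h ` p \<subseteq> carrier R'"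
        using that prime_spectrum_carrier[of p R] h_closed by auto
      have c: "\<iota>' c \<in> carrier R'" "j (\<iota>' c) = \<iota> c"
        using \<iota> h_closed j_h by metis+
      show ?thesis
        using inv.image_stalk(1)[OF pc(2) c(1) R'.one_closed] pc(1) c(2)
        by (simp add: j_image_h_image inv.h_one)
    qed
    then show ?thesis
      by (simp add: Spec_def pull_sections_def fun_eq_iff restrict_def)
  qed
  have re: "pull_sections h j R V (restr (Spec R' \<iota>') U V \<sigma>) =
      restr (Spec R \<iota>) {p \<in> prime_spectrum R. h ` p \<in> U} {p \<in> prime_spectrum R. h ` p \<in> V}
        (pull_sections h j R U \<sigma>)" if "V \<subseteq> U" for U V \<sigma>
    using that by (auto simp: Spec_def pull_sections_def restrict_def fun_eq_iff)
  show ?thesis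
    unfolding cspace_iso_def under fst_conv snd_conv preim_Spec
    using homeomorphic_image pull_sections_iso sc re by blast
qed

text \<open>\<open>loc_map\<close> is a union over representatives as well, so the two composites
  are compared fraction by fraction; the comparison rests on the commutation of \<open>j\<close>
  with the two maps.\<close>

lemma Spec_intertwines:
  assumes \<phi>: "\<And>a. a \<in> carrier R \<Longrightarrow> \<phi> a \<in> carrier R"
    and \<psi>: "\<And>a. a \<in> carrier R \<Longrightarrow> \<psi> (h a) = h (\<phi> a)"
  shows "intertwines (Spec R \<iota>) (Spec R' \<iota>') ((`) h, pull_sections h j R)
    (Spec_map R R \<phi>) (Spec_map R' R' \<psi>)"
proof -
  have \<psi>_closed: "\<psi> b \<in> carrier R'" and j\<psi>: "j (\<psi> b) = \<phi> (j b)" if "b \<in> carrier R'" for b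
    using that \<phi> \<psi>[of "j b"] by (auto simp: h_j j_h h_closed j_closed)
  have pt: "h ` {a \<in> carrier R. \<phi> a \<in> p} = {b \<in> carrier R'. \<psi> b \<in> h ` p}" if "p \<subseteq> carrier R" for p
    using that by (auto simp: h_image_vimage h_closed j_h h_j j_closed \<phi> \<psi>_closed j\<psi>)
  have sec: "snd (Spec_map R R \<phi>) {p \<in> prime_spectrum R. h ` p \<in> U} (pull_sections h j R U \<sigma>) =
      pull_sections h j R (preim (Spec R' \<iota>') (fst (Spec_map R' R' \<psi>)) U) (snd (Spec_map R' R' \<psi>) U \<sigma>)"
    (is "?l = ?r") if U: "openin (zariski R') U" and \<sigma>: "\<sigma> \<in> spec_sections R' U" for U \<sigma>
  proof
    fix p
    have Us: "U \<subseteq> prime_spectrum R'"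
      using openin_subset[OF U] by (simp add: topspace_zariski R'.ring_axioms)
    let ?q = "{a \<in> carrier R. \<phi> a \<in> p}" and ?q' = "{b \<in> carrier R'. \<psi> b \<in> h ` p}"
    show "?l p = ?r p"
    proof (cases "p \<in> prime_spectrum R \<and> ?q' \<in> U")
      case True
      then have pc: "p \<subseteq> carrier R" "h ` p \<subseteq> carrier R'"
        using prime_spectrum_carrier[of p R] h_closed by auto
      have hq: "h ` ?q = ?q'" by (rule pt[OF pc(1)])
      have "j ` h ` ?q = ?q" by (rule j_image_h_image) auto
      \<comment> \<open>Primality of \<open>?q\<close> comes from \<open>?q'\<close> being a point
        of \<open>U\<close>, because \<open>j\<close> carries \<open>?q'\<close> onto
        \<open>?q\<close>.\<close>
      then have q: "?q \<in> prime_spectrum R"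
        using True Us inv.prime_image[of ?q'] unfolding hq by auto
      have x: "\<sigma> ?q' \<in> carrier (stalk R' ?q')"
        using True \<sigma> by (auto simp: spec_sections_def)
      note xD = stalk_carrierD[OF x]
      have "?l p = loc_map R (carrier R - p) \<phi> (map_prod j j ` \<sigma> ?q')"
        using True q by (simp add: Spec_map_def pull_sections_def hq)
      also have "\<dots> = (\<Union>u\<in>\<sigma> ?q'. frac R (carrier R - p) (\<phi> (j (fst u))) (\<phi> (j (snd u))))"
        by (simp add: loc_map_def split_beta)
      also have "\<dots> = (\<Union>u\<in>\<sigma> ?q'. map_prod j j ` frac R' (carrier R' - h ` p) (\<psi> (fst u)) (\<psi> (snd u)))"
      proof (intro SUP_cong refl)
        fix u assume "u \<in> \<sigma> ?q'"
        then have u: "fst u \<in> carrier R'" "snd u \<in> carrier R'"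
          using xD[of "fst u" "snd u"] by auto
        show "frac R (carrier R - p) (\<phi> (j (fst u))) (\<phi> (j (snd u))) =
            map_prod j j ` frac R' (carrier R' - h ` p) (\<psi> (fst u)) (\<psi> (snd u))"
          by (simp only: inv.image_stalk(1)[OF pc(2) \<psi>_closed[OF u(1)] \<psi>_closed[OF u(2)]]
              j_image_h_image[OF pc(1)] j\<psi>[OF u(1)] j\<psi>[OF u(2)])
      qed
      also have "\<dots> = ?r p"
        using True prime_image[of p]
        by (simp add: Spec_map_def pull_sections_def loc_map_def split_beta image_UN
            preim_def Spec_def topspace_zariski R'.ring_axioms)
      finally show ?thesis .
    next
      case False
      then show ?thesis
        using pt[OF prime_spectrum_carrier, of p]
        by (auto simp: Spec_map_def pull_sections_def preim_def)
    qed
  qed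
  show ?thesis
    unfolding intertwines_def fst_conv snd_conv preim_Spec
    using sec pt[OF prime_spectrum_carrier]
    by (auto simp: Spec_def topspace_zariski R.ring_axioms Spec_map_def)
qed

end

theorem Spec_equivariantly_isomorphic:
  assumes "cring R" and h: "h \<in> ring_iso R R'" and zero: "h \<zero>\<^bsub>R\<^esub> = \<zero>\<^bsub>R'\<^esub>"
    and \<iota>: "\<And>c. \<iota> c \<in> carrier R" "\<And>c. h (\<iota> c) = \<iota>' c"
    and \<phi>: "\<And>\<mu> a. \<mu> \<noteq> 0 \<Longrightarrow> a \<in> carrier R \<Longrightarrow> \<phi> \<mu> a \<in> carrier R"
    and \<psi>: "\<And>\<mu> a. \<mu> \<noteq> 0 \<Longrightarrow> a \<in> carrier R \<Longrightarrow> \<psi> \<mu> (h a) = h (\<phi> \<mu> a)"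
  shows "equivariantly_isomorphic (Spec R \<iota>) (\<lambda>\<mu>. Spec_map R R (\<phi> \<mu>))
    (Spec R' \<iota>') (\<lambda>\<mu>. Spec_map R' R' (\<psi> \<mu>))"
proof -
  interpret R: cring R by fact
  define j where "j = inv_into (carrier R) h"
  have bij: "bij_betw h (carrier R) (carrier R')" using ring_iso_memE(5)[OF h] .
  \<comment> \<open>Membership in \<open>ring_iso\<close> does not mention zero: transport of the
    ring laws yields \<open>R'\<close> with its zero replaced by the image of zero, which the
    assumption \<open>zero\<close> identifies.\<close>
  have "cring R'"
    using R.ring_iso_imp_img_cring[OF h] by (simp add: zero)
  moreover have "j \<in> ring_hom R' R"
    using ring_iso_set_sym[OF R.ring_axioms h] by (simp add: j_def ring_iso_def)
  ultimately interpret ring_isomorphism R R' h j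
    using h bij
    by (intro ring_isomorphism.intro ring_isomorphism_axioms.intro R.cring_axioms)
      (auto simp: ring_iso_def j_def bij_betw_inv_into_left bij_betw_inv_into_right)
  show ?thesis
    unfolding equivariantly_isomorphic_def
  proof (intro exI conjI allI impI)
    show "cspace_iso (Spec R \<iota>) (Spec R' \<iota>') ((`) h, pull_sections h j R)"
      by (rule Spec_iso) (simp_all add: \<iota>)
    show "intertwines (Spec R \<iota>) (Spec R' \<iota>') ((`) h, pull_sections h j R)
        (Spec_map R R (\<phi> \<mu>)) (Spec_map R' R' (\<psi> \<mu>))" if "\<mu> \<noteq> 0" for \<mu>
      using that by (intro Spec_intertwines \<phi> \<psi>)
  qed
qed

section \<open>Localization\<close>

lemma cring_ring_on: "cring (ring_on (UNIV :: 'a::comm_ring_1 set))"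
proof (intro cringI abelian_groupI comm_monoidI)
  show "\<exists>y\<in>carrier (ring_on UNIV). y \<oplus>\<^bsub>ring_on UNIV\<^esub> x = \<zero>\<^bsub>ring_on UNIV\<^esub>" for x :: 'a
    by (auto simp: ring_on_def intro: exI[of _ "- x"])
qed (auto simp: ring_on_def algebra_simps)

locale cring_localization = cring R for R (structure) +
  fixes T
  assumes T_carrier: "T \<subseteq> carrier R" and one_T: "\<one> \<in> T"
    and mult_T: "s \<in> T \<Longrightarrow> t \<in> T \<Longrightarrow> s \<otimes> t \<in> T"
begin

lemma frac_mem_iff:
  "(b, t) \<in> frac R T a s \<longleftrightarrow> b \<in> carrier R \<and> t \<in> T \<and> (\<exists>w\<in>T. w \<otimes> (a \<otimes> t) = w \<otimes> (b \<otimes> s))"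
  by (simp add: frac_def)

lemma frac_self: "a \<in> carrier R \<Longrightarrow> s \<in> T \<Longrightarrow> (a, s) \<in> frac R T a s"
  using one_T by (auto simp: frac_mem_iff)

text \<open>Denominators may be zero divisors, so \<open>t\<close> cannot be cancelled; it is
  absorbed, together with both witnesses, into the new witness \<open>w t v\<close>.\<close>

lemma frac_trans:
  assumes ab: "w \<otimes> (a \<otimes> t) = w \<otimes> (b \<otimes> s)" and bc: "v \<otimes> (b \<otimes> r) = v \<otimes> (c \<otimes> t)"
    and c: "a \<in> carrier R" "b \<in> carrier R" "c \<in> carrier R"
      "s \<in> T" "t \<in> T" "r \<in> T" "w \<in> T" "v \<in> T"
  shows "(w \<otimes> v \<otimes> t) \<otimes> (a \<otimes> r) = (w \<otimes> v \<otimes> t) \<otimes> (c \<otimes> s)"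
proof -
  note [simp] = c c(4-8)[THEN subsetD[OF T_carrier]]
  have "(w \<otimes> v \<otimes> t) \<otimes> (a \<otimes> r) = (w \<otimes> (a \<otimes> t)) \<otimes> (v \<otimes> r)" by (simp add: m_ac)
  also have "\<dots> = (v \<otimes> (b \<otimes> r)) \<otimes> (w \<otimes> s)" unfolding ab by (simp add: m_ac)
  also have "\<dots> = (w \<otimes> v \<otimes> t) \<otimes> (c \<otimes> s)" unfolding bc by (simp add: m_ac)
  finally show ?thesis .
qed

lemma frac_eq_iff:
  assumes "a \<in> carrier R" "b \<in> carrier R" "s \<in> T" "t \<in> T"
  shows "frac R T a s = frac R T b t \<longleftrightarrow> (\<exists>w\<in>T. w \<otimes> (a \<otimes> t) = w \<otimes> (b \<otimes> s))"
proof
  assume "frac R T a s = frac R T b t"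
  then have "(b, t) \<in> frac R T a s" using frac_self[of b t] assms by simp
  then show "\<exists>w\<in>T. w \<otimes> (a \<otimes> t) = w \<otimes> (b \<otimes> s)" by (simp add: frac_mem_iff)
next
  have sub: "frac R T a s \<subseteq> frac R T b t"
    if "a \<in> carrier R" "b \<in> carrier R" "s \<in> T" "t \<in> T"
      and w: "w \<in> T" "w \<otimes> (a \<otimes> t) = w \<otimes> (b \<otimes> s)" for a b s t w
  proof safe
    fix c r assume "(c, r) \<in> frac R T a s"
    then obtain v where v: "c \<in> carrier R" "r \<in> T" "v \<in> T" "v \<otimes> (a \<otimes> r) = v \<otimes> (c \<otimes> s)"
      by (auto simp: frac_mem_iff)
    have "(w \<otimes> v \<otimes> s) \<otimes> (b \<otimes> r) = (w \<otimes> v \<otimes> s) \<otimes> (c \<otimes> t)"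
      by (rule frac_trans[OF w(2)[symmetric] v(4)]) (use that v in auto)
    moreover have "w \<otimes> v \<otimes> s \<in> T" using that v by (intro mult_T)
    ultimately show "(c, r) \<in> frac R T b t" using v by (auto simp: frac_mem_iff)
  qed
  assume "\<exists>w\<in>T. w \<otimes> (a \<otimes> t) = w \<otimes> (b \<otimes> s)"
  then obtain w where "w \<in> T" "w \<otimes> (a \<otimes> t) = w \<otimes> (b \<otimes> s)" by auto
  then show "frac R T a s = frac R T b t"
    using sub[of a b s t w] sub[of b a t s w] assms by auto
qed

text \<open>The operations of \<open>localization\<close> are unions over representatives. Such a
  union collapses to one term once that term is independent of the representative, so this reduces
  each operation to its well-definedness.\<close>

lemma UN_frac_const:
  assumes "a \<in> carrier R" "s \<in> T"
    and "\<And>b t. (b, t) \<in> frac R T a s \<Longrightarrow> G b t = G a s"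
  shows "(\<Union>(b, t)\<in>frac R T a s. G b t) = G a s"
  by (rule UN_constant_eq[OF frac_self[OF assms(1,2)]]) (use assms(3) in auto)

lemma frac_memD:
  assumes "(b, t) \<in> frac R T a s"
  shows "b \<in> carrier R" "t \<in> T" "t \<in> carrier R" "\<exists>w\<in>T. w \<otimes> (a \<otimes> t) = w \<otimes> (b \<otimes> s)"
  using assms T_carrier by (auto simp: frac_mem_iff)

lemma frac_mult:
  assumes "a \<in> carrier R" "b \<in> carrier R" "s \<in> T" "t \<in> T"
  shows "frac R T a s \<otimes>\<^bsub>localization R T\<^esub> frac R T b t = frac R T (a \<otimes> b) (s \<otimes> t)"
proof -
  have eq: "frac R T (a' \<otimes> b') (s' \<otimes> t') = frac R T (a \<otimes> b) (s \<otimes> t)"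
    if m: "(a', s') \<in> frac R T a s" "(b', t') \<in> frac R T b t" for a' b' s' t'
  proof -
    note D = frac_memD[OF m(1)] frac_memD[OF m(2)]
    obtain w v where w: "w \<in> T" "w \<otimes> (a \<otimes> s') = w \<otimes> (a' \<otimes> s)"
      and v: "v \<in> T" "v \<otimes> (b \<otimes> t') = v \<otimes> (b' \<otimes> t)" using D(4,8) by auto
    note [simp] = assms D(1-3,5-7) w(1) v(1)
      subsetD[OF T_carrier assms(3)] subsetD[OF T_carrier assms(4)]
      subsetD[OF T_carrier w(1)] subsetD[OF T_carrier v(1)]
    have "(w \<otimes> v) \<otimes> ((a' \<otimes> b') \<otimes> (s \<otimes> t)) = (w \<otimes> (a' \<otimes> s)) \<otimes> (v \<otimes> (b' \<otimes> t))"
      by (simp add: m_ac)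
    also have "\<dots> = (w \<otimes> v) \<otimes> ((a \<otimes> b) \<otimes> (s' \<otimes> t'))"
      unfolding w(2)[symmetric] v(2)[symmetric] by (simp add: m_ac)
    finally show ?thesis by (subst frac_eq_iff) (auto intro!: mult_T bexI[of _ "w \<otimes> v"])
  qed
  have "frac R T a s \<otimes>\<^bsub>localization R T\<^esub> frac R T b t =
      (\<Union>(a', s')\<in>frac R T a s. \<Union>(b', t')\<in>frac R T b t. frac R T (a' \<otimes> b') (s' \<otimes> t'))"
    by (simp add: localization_def)
  also have "\<dots> = (\<Union>(b', t')\<in>frac R T b t. frac R T (a \<otimes> b') (s \<otimes> t'))"
    by (rule UN_frac_const[OF assms(1,3)])
      (use eq frac_self[OF assms(1,3)] in \<open>auto intro!: SUP_cong\<close>)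
  also have "\<dots> = frac R T (a \<otimes> b) (s \<otimes> t)"
    by (rule UN_frac_const[OF assms(2,4)]) (use eq frac_self[OF assms(1,3)] in auto)
  finally show ?thesis .
qed

lemma frac_add:
  assumes "a \<in> carrier R" "b \<in> carrier R" "s \<in> T" "t \<in> T"
  shows "frac R T a s \<oplus>\<^bsub>localization R T\<^esub> frac R T b t =
    frac R T ((a \<otimes> t) \<oplus> (b \<otimes> s)) (s \<otimes> t)"
proof -
  have eq: "frac R T ((a' \<otimes> t') \<oplus> (b' \<otimes> s')) (s' \<otimes> t') = frac R T ((a \<otimes> t) \<oplus> (b \<otimes> s)) (s \<otimes> t)"
    if m: "(a', s') \<in> frac R T a s" "(b', t') \<in> frac R T b t" for a' b' s' t'
  proof -
    note D = frac_memD[OF m(1)] frac_memD[OF m(2)]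
    obtain w v where w: "w \<in> T" "w \<otimes> (a \<otimes> s') = w \<otimes> (a' \<otimes> s)"
      and v: "v \<in> T" "v \<otimes> (b \<otimes> t') = v \<otimes> (b' \<otimes> t)" using D(4,8) by auto
    note [simp] = assms D(1-3,5-7) w(1) v(1)
      subsetD[OF T_carrier assms(3)] subsetD[OF T_carrier assms(4)]
      subsetD[OF T_carrier w(1)] subsetD[OF T_carrier v(1)]
    have "(w \<otimes> v) \<otimes> (((a' \<otimes> t') \<oplus> (b' \<otimes> s')) \<otimes> (s \<otimes> t)) =
        (w \<otimes> (a' \<otimes> s)) \<otimes> (v \<otimes> (t \<otimes> t')) \<oplus> (v \<otimes> (b' \<otimes> t)) \<otimes> (w \<otimes> (s \<otimes> s'))"
      by (simp add: m_ac l_distr r_distr)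
    also have "\<dots> = (w \<otimes> v) \<otimes> (((a \<otimes> t) \<oplus> (b \<otimes> s)) \<otimes> (s' \<otimes> t'))"
      unfolding w(2)[symmetric] v(2)[symmetric] by (simp add: m_ac l_distr r_distr)
    finally show ?thesis by (subst frac_eq_iff) (auto intro!: mult_T bexI[of _ "w \<otimes> v"])
  qed
  have "frac R T a s \<oplus>\<^bsub>localization R T\<^esub> frac R T b t =
      (\<Union>(a', s')\<in>frac R T a s. \<Union>(b', t')\<in>frac R T b t.
        frac R T ((a' \<otimes> t') \<oplus> (b' \<otimes> s')) (s' \<otimes> t'))"
    by (simp add: localization_def)
  also have "\<dots> = (\<Union>(b', t')\<in>frac R T b t. frac R T ((a \<otimes> t') \<oplus> (b' \<otimes> s)) (s \<otimes> t'))"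
    by (rule UN_frac_const[OF assms(1,3)])
      (use eq frac_self[OF assms(1,3)] in \<open>auto intro!: SUP_cong\<close>)
  also have "\<dots> = frac R T ((a \<otimes> t) \<oplus> (b \<otimes> s)) (s \<otimes> t)"
    by (rule UN_frac_const[OF assms(2,4)]) (use eq frac_self[OF assms(1,3)] in auto)
  finally show ?thesis .
qed

lemma loc_map_frac:
  assumes \<psi>: "\<And>x. x \<in> carrier R \<Longrightarrow> \<psi> x \<in> carrier R" "\<And>x. x \<in> T \<Longrightarrow> \<psi> x \<in> T"
    "\<And>x y. x \<in> carrier R \<Longrightarrow> y \<in> carrier R \<Longrightarrow> \<psi> (x \<otimes> y) = \<psi> x \<otimes> \<psi> y"
    and "a \<in> carrier R" "s \<in> T"
  shows "loc_map R T \<psi> (frac R T a s) = frac R T (\<psi> a) (\<psi> s)"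
  unfolding loc_map_def
proof (rule UN_frac_const[OF assms(4,5)])
  fix b t assume m: "(b, t) \<in> frac R T a s"
  note D = frac_memD[OF m]
  obtain w where w: "w \<in> T" "w \<otimes> (a \<otimes> t) = w \<otimes> (b \<otimes> s)" using D(4) by auto
  have "w \<in> carrier R" "s \<in> carrier R" using w assms T_carrier by auto
  then have "\<psi> w \<otimes> (\<psi> b \<otimes> \<psi> s) = \<psi> w \<otimes> (\<psi> a \<otimes> \<psi> t)"
    using arg_cong[OF w(2), of \<psi>] D assms by simp
  then show "frac R T (\<psi> b) (\<psi> t) = frac R T (\<psi> a) (\<psi> s)"
    using D w assms by (subst frac_eq_iff) auto
qed

end

section \<open>Additive maps on finitely supported functions\<close>

text \<open>Additive extension of a map given on single terms. The coefficient is an argument of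
  \<open>f\<close> because it may change its ring, as when complex numbers become rational functions
  in \<open>t\<close>.\<close>

definition pm_extend :: "('a \<Rightarrow> 'b \<Rightarrow> 'c) \<Rightarrow> ('a \<Rightarrow>\<^sub>0 'b::zero) \<Rightarrow> 'c::comm_monoid_add" where
  "pm_extend f p = (\<Sum>m\<in>Poly_Mapping.keys p. f m (Poly_Mapping.lookup p m))"

lemma poly_mapping_sum_single:
  "(\<Sum>m\<in>Poly_Mapping.keys p. Poly_Mapping.single m (Poly_Mapping.lookup p m)) = p"
proof (rule poly_mapping_eqI)
  fix k
  have "(\<Sum>m\<in>Poly_Mapping.keys p. Poly_Mapping.lookup p m when m = k) = Poly_Mapping.lookup p k"
    by (simp add: when_def in_keys_iff)
  then show "Poly_Mapping.lookup (\<Sum>m\<in>Poly_Mapping.keys p. Poly_Mapping.single m (Poly_Mapping.lookup p m)) k =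
      Poly_Mapping.lookup p k"
    by (simp add: lookup_sum lookup_single)
qed

lemma pm_extend_superset:
  assumes "\<And>m. f m 0 = 0" "finite A" "Poly_Mapping.keys p \<subseteq> A"
  shows "pm_extend f p = (\<Sum>m\<in>A. f m (Poly_Mapping.lookup p m))"
  unfolding pm_extend_def using assms
  by (intro sum.mono_neutral_left) (auto simp: in_keys_iff)

context
  fixes f :: "'a \<Rightarrow> 'b::comm_monoid_add \<Rightarrow> 'c::comm_monoid_add"
  assumes f_0: "\<And>m. f m 0 = 0" and f_add: "\<And>m a b. f m (a + b) = f m a + f m b"
begin

lemma pm_extend_0: "pm_extend f 0 = 0"
  by (simp add: pm_extend_def)

lemma pm_extend_single: "pm_extend f (Poly_Mapping.single m c) = f m c"
  by (cases "c = 0") (auto simp: pm_extend_def f_0)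

lemma pm_extend_add: "pm_extend f (p + q) = pm_extend f p + pm_extend f q"
proof -
  let ?A = "Poly_Mapping.keys p \<union> Poly_Mapping.keys q"
  have "Poly_Mapping.keys (p + q) \<subseteq> ?A" by (rule Poly_Mapping.keys_add)
  then show ?thesis
    by (simp add: pm_extend_superset[of f ?A, OF f_0] lookup_add f_add sum.distrib)
qed

lemma pm_extend_sum: "pm_extend f (\<Sum>i\<in>I. p i) = (\<Sum>i\<in>I. pm_extend f (p i))"
  by (induction I rule: infinite_finite_induct) (simp_all add: pm_extend_0 pm_extend_add)

end

lemma pm_extend_mult:
  fixes f :: "'a::comm_monoid_add \<Rightarrow> 'b::comm_semiring_0 \<Rightarrow> 'c::comm_semiring_0"
  assumes f_0: "\<And>m. f m 0 = 0" and f_add: "\<And>m a b. f m (a + b) = f m a + f m b"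
    and f_mult: "\<And>m n a b. f (m + n) (a * b) = f m a * f n b"
  shows "pm_extend f (p * q) = pm_extend f p * pm_extend f q"
proof -
  let ?s = "\<lambda>p m. Poly_Mapping.single m (Poly_Mapping.lookup p m)"
  have "p * q = (\<Sum>m\<in>Poly_Mapping.keys p. ?s p m) * (\<Sum>n\<in>Poly_Mapping.keys q. ?s q n)"
    by (simp only: poly_mapping_sum_single)
  also have "\<dots> = (\<Sum>m\<in>Poly_Mapping.keys p. \<Sum>n\<in>Poly_Mapping.keys q.
      Poly_Mapping.single (m + n) (Poly_Mapping.lookup p m * Poly_Mapping.lookup q n))"
    by (simp add: sum_product mult_single)
  also have "pm_extend f \<dots> = (\<Sum>m\<in>Poly_Mapping.keys p. \<Sum>n\<in>Poly_Mapping.keys q.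
      f m (Poly_Mapping.lookup p m) * f n (Poly_Mapping.lookup q n))"
    by (simp add: pm_extend_sum[of f, OF f_0 f_add] pm_extend_single[of f, OF f_0 f_add] f_mult)
  also have "\<dots> = pm_extend f p * pm_extend f q"
    by (simp add: pm_extend_def sum_product)
  finally show ?thesis .
qed

section \<open>Divisors of rational functions\<close>

text \<open>Cross multiplication and additivity of \<open>order\<close> make the difference of
  orders independent of the chosen fraction.\<close>

lemma div_fract_Fract:
  assumes "p \<noteq> 0" "q \<noteq> 0"
  shows "div_fract (Fract p q) c = int (Polynomial.order c p) - int (Polynomial.order c q)"
  unfolding div_fract_def
proof (rule the_equality)
  fix n
  assume "\<exists>p' q'. p' \<noteq> 0 \<and> q' \<noteq> 0 \<and> Fract p q = Fract p' q' \<and>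
     n = int (Polynomial.order c p') - int (Polynomial.order c q')"
  then obtain p' q' where pq: "p' \<noteq> 0" "q' \<noteq> 0" "Fract p q = Fract p' q'"
    and n: "n = int (Polynomial.order c p') - int (Polynomial.order c q')" by blast
  have "p * q' = p' * q" using pq assms by (simp add: eq_fract)
  then have "Polynomial.order c p + Polynomial.order c q' = Polynomial.order c p' + Polynomial.order c q"
    using pq assms by (metis order_mult mult_eq_0_iff)
  then show "n = int (Polynomial.order c p) - int (Polynomial.order c q)" using n by linarith
qed (use assms in blast)

lemma nonzero_fract_obtain:
  fixes f :: "'a::idom fract"
  assumes "f \<noteq> 0"
  obtains p q where "f = Fract p q" "p \<noteq> 0" "q \<noteq> 0"
  using assms by (cases f rule: Fract_cases_nonzero) auto

lemma Fract_ne_0: "p \<noteq> 0 \<Longrightarrow> q \<noteq> 0 \<Longrightarrow> Fract p q \<noteq> 0"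
  by (simp add: Zero_fract_def eq_fract)

lemma div_fract_mult:
  assumes "f \<noteq> 0" "g \<noteq> 0"
  shows "div_fract (f * g) c = div_fract f c + div_fract g c"
proof -
  obtain p q p' q' where "f = Fract p q" "p \<noteq> 0" "q \<noteq> 0" "g = Fract p' q'" "p' \<noteq> 0" "q' \<noteq> 0"
    using assms by (metis nonzero_fract_obtain)
  then show ?thesis by (simp add: div_fract_Fract order_mult)
qed

lemma div_fract_inverse:
  assumes "f \<noteq> 0"
  shows "div_fract (inverse f) c = - div_fract f c"
proof -
  obtain p q where "f = Fract p q" "p \<noteq> 0" "q \<noteq> 0"
    using assms by (metis nonzero_fract_obtain)
  then show ?thesis by (simp add: div_fract_Fract)
qed

lemma div_fract_1: "div_fract 1 c = 0"
  by (simp add: One_fract_def div_fract_Fract)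

lemma div_fract_power: "f \<noteq> 0 \<Longrightarrow> div_fract (f ^ n) c = int n * div_fract f c"
  by (induction n) (auto simp: div_fract_1 div_fract_mult algebra_simps)

lemma div_fract_powi: "f \<noteq> 0 \<Longrightarrow> div_fract (f powi n) c = n * div_fract f c"
  by (auto simp: power_int_def div_fract_power div_fract_inverse)

lemma div_fract_const: "a \<noteq> 0 \<Longrightarrow> div_fract (Fract [:a:] 1) c = 0"
  by (simp add: div_fract_Fract order_0I)

lemma div_fract_T: "div_fract (Fract [:0, 1:] 1) c = (if c = 0 then 1 else 0)"
proof -
  have "Polynomial.order 0 [:0, 1 :: complex:] = 1"
    using order_power_n_n[of 0 1] by simp
  then show ?thesis by (auto simp: div_fract_Fract order_0I)
qed

text \<open>A nonconstant \<open>q\<close> has a complex root, which by the order comparison is a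
  root of \<open>p\<close> too; the common linear factor is split off from both.\<close>

lemma dvd_of_order_le:
  fixes p q :: "complex poly"
  assumes "p \<noteq> 0" "q \<noteq> 0" "\<And>c. Polynomial.order c q \<le> Polynomial.order c p"
  shows "q dvd p"
  using assms
proof (induction "Polynomial.degree q" arbitrary: p q)
  case 0
  then obtain a where "q = [:a:]" by (metis degree_eq_zeroE)
  with 0 show ?case by (metis const_poly_dvd_iff dvd_field_iff pCons_0_0)
next
  case (Suc n)
  then have "\<not> constant (poly q)" by (simp add: constant_degree)
  then obtain c where c: "poly q c = 0" using fundamental_theorem_of_algebra by blast
  then have "Polynomial.order c p > 0" using Suc.prems order_root[of q c] by (metis gr0I le_zero_eq)
  then have "poly p c = 0" by (metis order_root less_numeral_extra(3))
  with c obtain p' q' where pq: "p = [:-c, 1:] * p'" "q = [:-c, 1:] * q'"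
    by (metis dvdE poly_eq_0_iff_dvd)
  then have nz: "p' \<noteq> 0" "q' \<noteq> 0" using Suc.prems by auto
  have "Polynomial.order x q' \<le> Polynomial.order x p'" for x
    using Suc.prems(1,2) Suc.prems(3)[of x] unfolding pq by (simp add: order_mult del: mult_pCons_left)
  moreover have "n = Polynomial.degree q'"
    using Suc.hyps(2) nz unfolding pq by (simp add: degree_mult_eq del: mult_pCons_left)
  ultimately have "q' dvd p'" using Suc.hyps(1) nz by blast
  then show ?case unfolding pq by (rule mult_dvd_mono[OF dvd_refl])
qed

text \<open>For \<open>f = p/q\<close> the hypothesis compares the orders of \<open>p\<close> and
  \<open>q\<close> at every point, hence \<open>q\<close> divides \<open>p\<close>.\<close>

lemma polynomial_of_div_nonneg:
  assumes "f = 0 \<or> (\<forall>c. div_fract f c \<ge> 0)"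
  shows "\<exists>p. f = Fract p 1"
proof (cases "f = 0")
  case True
  then show ?thesis by (metis Zero_fract_def)
next
  case False
  then obtain p q where f: "f = Fract p q" "p \<noteq> 0" "q \<noteq> 0" by (metis nonzero_fract_obtain)
  then have "q dvd p"
    using assms False by (intro dvd_of_order_le) (auto simp: div_fract_Fract)
  then obtain r where "p = q * r" by (auto elim: dvdE)
  then show ?thesis using f by (auto simp: eq_fract intro!: exI[of _ r])
qed

section \<open>Weighted homogeneous polynomials\<close>

lemma weighted_degree_expand:
  "weighted_degree w m = w X * int (Poly_Mapping.lookup m X) + w Y * int (Poly_Mapping.lookup m Y) +
     w Z * int (Poly_Mapping.lookup m Z) + w S * int (Poly_Mapping.lookup m S)"
proof -
  have "weighted_degree w m = (\<Sum>v\<in>{X, Y, Z, S}. w v * int (Poly_Mapping.lookup m v))"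
    unfolding weighted_degree_def
  proof (rule sum.mono_neutral_left)
    show "Poly_Mapping.keys m \<subseteq> {X, Y, Z, S}" using var.exhaust by blast
  qed (auto simp: in_keys_iff)
  then show ?thesis by (simp add: algebra_simps)
qed

lemma weighted_degree_add: "weighted_degree w (m + n) = weighted_degree w m + weighted_degree w n"
  by (simp add: weighted_degree_expand lookup_add algebra_simps)

lemma weighted_degree_0: "weighted_degree w 0 = 0"
  by (simp add: weighted_degree_expand)

lemma weighted_homogeneous_single:
  "weighted_degree w m = n \<Longrightarrow> weighted_homogeneous w n (Poly_Mapping.single m c)"
  by (cases "c = 0") (auto simp: weighted_homogeneous_def)

lemma weighted_homogeneous_0: "weighted_homogeneous w n 0"
  by (simp add: weighted_homogeneous_def)

lemma weighted_homogeneous_add: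
  "weighted_homogeneous w n p \<Longrightarrow> weighted_homogeneous w n q \<Longrightarrow> weighted_homogeneous w n (p + q)"
  using Poly_Mapping.keys_add[of p q] by (auto simp: weighted_homogeneous_def)

lemma weighted_homogeneous_uminus:
  "weighted_homogeneous w n p \<Longrightarrow> weighted_homogeneous w n (- p)"
  by (auto simp: weighted_homogeneous_def in_keys_iff)

lemma weighted_homogeneous_diff:
  "weighted_homogeneous w n p \<Longrightarrow> weighted_homogeneous w n q \<Longrightarrow> weighted_homogeneous w n (p - q)"
  using weighted_homogeneous_add[of w n p "- q"] weighted_homogeneous_uminus[of w n q] by simp

lemma weighted_homogeneous_sum:
  "(\<And>i. i \<in> I \<Longrightarrow> weighted_homogeneous w n (p i)) \<Longrightarrow> weighted_homogeneous w n (\<Sum>i\<in>I. p i)"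
  by (induction I rule: infinite_finite_induct)
    (auto simp: weighted_homogeneous_0 intro!: weighted_homogeneous_add)

lemma weighted_homogeneous_mult:
  assumes "weighted_homogeneous w m p" "weighted_homogeneous w n q"
  shows "weighted_homogeneous w (m + n) (p * q)"
  using assms Poly_Mapping.keys_mult[of p q]
  by (auto simp: weighted_homogeneous_def weighted_degree_add dest!: subsetD)

lemma weighted_homogeneous_Const: "weighted_homogeneous w 0 (Const c)"
  unfolding Const_def by (rule weighted_homogeneous_single) (rule weighted_degree_0)

lemma weighted_homogeneous_Var: "weighted_homogeneous w (w v) (Var v)"
  unfolding Var_def
  by (rule weighted_homogeneous_single) (cases v; simp add: weighted_degree_expand lookup_single)

lemma weighted_homogeneous_power:
  "weighted_homogeneous w n p \<Longrightarrow> weighted_homogeneous w (int j * n) (p ^ j)"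
proof (induction j)
  case 0
  show ?case using weighted_homogeneous_Const[of w 1] by (simp add: Const_def)
next
  case (Suc j)
  then show ?case using weighted_homogeneous_mult[of w n p "int j * n" "p ^ j"]
    by (simp add: algebra_simps)
qed

lemma Var_power: "Var v ^ n = Poly_Mapping.single (Poly_Mapping.single v n) 1"
proof (induction n)
  case (Suc n)
  then show ?case
    by (simp add: Var_def mult_single flip: Poly_Mapping.single_add)
qed simp

lemma lookup_torus_subst:
  "Poly_Mapping.lookup (torus_subst w \<mu> p) m = \<mu> powi weighted_degree w m * Poly_Mapping.lookup p m"
  by (simp add: torus_subst_def lookup_mapp when_def in_keys_iff)

text \<open>Makes \<open>pm_extend_mult\<close> applicable. For nonzero \<open>\<mu>\<close> no term
  disappears, so both sums run over the same keys.\<close>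

lemma torus_subst_pm_extend:
  assumes "\<mu> \<noteq> 0"
  shows "torus_subst w \<mu> p = pm_extend (\<lambda>m c. Poly_Mapping.single m (\<mu> powi weighted_degree w m * c)) p"
proof -
  have "Poly_Mapping.keys (torus_subst w \<mu> p) = Poly_Mapping.keys p"
    using assms by (auto simp: in_keys_iff lookup_torus_subst)
  then show ?thesis
    using poly_mapping_sum_single[of "torus_subst w \<mu> p"]
    by (simp add: pm_extend_def lookup_torus_subst)
qed

lemma torus_subst_mult:
  assumes "\<mu> \<noteq> 0"
  shows "torus_subst w \<mu> (p * q) = torus_subst w \<mu> p * torus_subst w \<mu> q"
  unfolding torus_subst_pm_extend[OF assms]
  by (rule pm_extend_mult)
    (simp_all add: mult_single weighted_degree_add power_int_add assms single_add algebra_simps)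

lemma torus_subst_diff: "torus_subst w \<mu> (p - q) = torus_subst w \<mu> p - torus_subst w \<mu> q"
  by (rule poly_mapping_eqI) (simp add: lookup_minus lookup_torus_subst algebra_simps)

lemma torus_subst_inverse:
  "\<mu> \<noteq> 0 \<Longrightarrow> torus_subst w (inverse \<mu>) (torus_subst w \<mu> p) = p"
  by (rule poly_mapping_eqI) (simp add: lookup_torus_subst power_int_inverse)

lemma torus_subst_invariant:
  assumes "weighted_homogeneous w 0 p"
  shows "torus_subst w \<mu> p = p"
proof (rule poly_mapping_eqI)
  show "Poly_Mapping.lookup (torus_subst w \<mu> p) m = Poly_Mapping.lookup p m" for m
    using assms by (cases "m \<in> Poly_Mapping.keys p")
      (auto simp: lookup_torus_subst weighted_homogeneous_def in_keys_iff)
qed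

text \<open>The torus rescales terms and keeps their monomials, so it respects every other grading;
  this lets it act on the degree zero part.\<close>

lemma torus_subst_homogeneous:
  assumes "weighted_homogeneous v n p"
  shows "weighted_homogeneous v n (torus_subst w \<mu> p)"
  using assms by (auto simp: weighted_homogeneous_def in_keys_iff lookup_torus_subst)

section \<open>The coordinate ring of the chart\<close>

lemma hyp_ideal_eq: "hyp_ideal F = {p. F dvd p}"
  by (auto simp: hyp_ideal_def cgenideal_def ring_on_def dvd_def mult.commute)

lemma hyp_class_eq: "hyp_class F p = {x. F dvd x - p}"
proof (rule Set.set_eqI)
  fix x
  have "x \<in> hyp_class F p \<longleftrightarrow> (\<exists>h. F dvd h \<and> x = h + p)"
    by (simp add: hyp_class_def a_r_coset_def' hyp_ideal_eq ring_on_def)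
  also have "\<dots> \<longleftrightarrow> F dvd x - p"
    by (metis add_diff_cancel_right' diff_add_cancel)
  finally show "x \<in> hyp_class F p \<longleftrightarrow> x \<in> {x. F dvd x - p}" by simp
qed

lemma hyp_class_eq_iff: "hyp_class F p = hyp_class F q \<longleftrightarrow> F dvd p - q"
proof
  assume "hyp_class F p = hyp_class F q"
  moreover have "p \<in> hyp_class F p" by (simp add: hyp_class_eq)
  ultimately have "p \<in> hyp_class F q" by simp
  then show "F dvd p - q" by (simp add: hyp_class_eq)
next
  assume *: "F dvd p - q"
  have "F dvd x - p \<longleftrightarrow> F dvd x - q" for x
  proof -
    have "x - q = (x - p) + (p - q)" by simp
    then show ?thesis by (simp only: dvd_add_left_iff[OF *])
  qed
  then show "hyp_class F p = hyp_class F q" unfolding hyp_class_eq by simp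
qed

lemma ideal_hyp_ideal: "ideal (hyp_ideal F) (ring_on UNIV)"
  unfolding hyp_ideal_def
  by (rule cring.cgenideal_ideal[OF cring_ring_on]) (simp add: ring_on_def)

lemma cring_hyp_ring: "cring (hyp_ring F)"
  unfolding hyp_ring_def by (rule ideal.quotient_is_cring[OF ideal_hyp_ideal cring_ring_on])

lemma hyp_class_hom: "hyp_class F \<in> ring_hom (ring_on UNIV) (hyp_ring F)"
  using ideal.rcos_ring_hom[OF ideal_hyp_ideal]
  unfolding hyp_ring_def hyp_class_def[abs_def] .

lemma hyp_class_simps:
  "hyp_class F p \<in> carrier (hyp_ring F)"
  "hyp_class F p \<otimes>\<^bsub>hyp_ring F\<^esub> hyp_class F q = hyp_class F (p * q)"
  "hyp_class F p \<oplus>\<^bsub>hyp_ring F\<^esub> hyp_class F q = hyp_class F (p + q)"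
  "\<one>\<^bsub>hyp_ring F\<^esub> = hyp_class F 1"
  using hyp_class_hom[of F] by (auto simp: ring_hom_def ring_on_def)

lemma hyp_class_0: "\<zero>\<^bsub>hyp_ring F\<^esub> = hyp_class F 0"
  using ring_hom_zero[OF hyp_class_hom[of F] cring.axioms(1)[OF cring_ring_on]
      cring.axioms(1)[OF cring_hyp_ring]]
  by (simp add: ring_on_def)

lemma hyp_ring_carrierE:
  assumes "x \<in> carrier (hyp_ring F)"
  obtains p where "x = hyp_class F p"
  using assms by (auto simp: hyp_ring_def FactRing_def A_RCOSETS_def' hyp_class_def ring_on_def)

lemma cring_localization_hyp_ring: "cring_localization (hyp_ring F) (z_powers F)"
proof (intro cring_localization.intro cring_localization_axioms.intro cring_hyp_ring)
  show "\<one>\<^bsub>hyp_ring F\<^esub> \<in> z_powers F"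
    unfolding z_powers_def hyp_class_simps(4) by (rule range_eqI[of _ _ 0]) simp
  show "s \<otimes>\<^bsub>hyp_ring F\<^esub> t \<in> z_powers F" if "s \<in> z_powers F" "t \<in> z_powers F" for s t
    using that by (auto simp: z_powers_def hyp_class_simps simp flip: power_add)
qed (auto simp: z_powers_def hyp_class_simps)

definition chart_frac :: "mpoly4 \<Rightarrow> mpoly4 \<Rightarrow> nat \<Rightarrow> (mpoly4 set \<times> mpoly4 set) set" where
  "chart_frac F p n = frac (hyp_ring F) (z_powers F) (hyp_class F p) (hyp_class F (Var Z ^ n))"

lemma z_power_mem: "hyp_class F (Var Z ^ n) \<in> z_powers F"
  by (simp add: z_powers_def)

lemma bex_z_powers: "(\<exists>w\<in>z_powers F. P w) \<longleftrightarrow> (\<exists>j. P (hyp_class F (Var Z ^ j)))"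
  by (simp add: z_powers_def)

text \<open>Reduces equality in the chart to divisibility of polynomials. The power
  \<open>z^j\<close> is the localization witness; \<open>z\<close> is not known to be a
  nonzerodivisor modulo \<open>F\<close>.\<close>

lemma chart_frac_eq_iff:
  "chart_frac F p n = chart_frac F q m \<longleftrightarrow> (\<exists>j. F dvd Var Z ^ j * (p * Var Z ^ m - q * Var Z ^ n))"
  unfolding chart_frac_def
  by (subst cring_localization.frac_eq_iff[OF cring_localization_hyp_ring])
    (simp_all add: hyp_class_simps z_power_mem bex_z_powers hyp_class_eq_iff right_diff_distrib)

lemma chart_frac_mult:
  "chart_frac F p n \<otimes>\<^bsub>chart_ring F w\<^esub> chart_frac F q m = chart_frac F (p * q) (n + m)"
  using cring_localization.frac_mult[OF cring_localization_hyp_ring, of "hyp_class F p" F "hyp_class F q"]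
  by (simp add: chart_frac_def chart_ring_def hyp_class_simps z_power_mem power_add)

lemma chart_frac_add:
  "chart_frac F p n \<oplus>\<^bsub>chart_ring F w\<^esub> chart_frac F q m =
    chart_frac F (p * Var Z ^ m + q * Var Z ^ n) (n + m)"
  using cring_localization.frac_add[OF cring_localization_hyp_ring, of "hyp_class F p" F "hyp_class F q"]
  by (simp add: chart_frac_def chart_ring_def hyp_class_simps z_power_mem power_add)

lemma chart_frac_one: "\<one>\<^bsub>chart_ring F w\<^esub> = chart_frac F 1 0"
  and chart_frac_zero: "\<zero>\<^bsub>chart_ring F w\<^esub> = chart_frac F 0 0"
  and chart_frac_const: "chart_const F c = chart_frac F (Const c) 0"
  by (simp_all add: chart_ring_def localization_def chart_frac_def hyp_class_simps hyp_class_0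
      chart_const_def)

lemma chart_ring_carrier:
  "carrier (chart_ring F w) = {chart_frac F p n | p n. weighted_homogeneous w (int n * w Z) p}"
  by (simp add: chart_ring_def chart_frac_def)

text \<open>\<open>chart_torus\<close> acts on cosets as sets of polynomials. The image fills the
  whole coset because the substitution by \<open>inverse \<mu>\<close> undoes it and also preserves
  divisibility by the invariant \<open>F\<close>.\<close>

lemma torus_subst_hyp_class:
  assumes "\<mu> \<noteq> 0" "weighted_homogeneous \<chi> 0 F"
  shows "torus_subst \<chi> \<mu> ` hyp_class F p = hyp_class F (torus_subst \<chi> \<mu> p)"
proof -
  have dvd: "F dvd torus_subst \<chi> \<nu> q" if "F dvd q" "\<nu> \<noteq> 0" for q \<nu>
    using that torus_subst_invariant[OF assms(2)] by (auto simp: dvd_def torus_subst_mult)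
  have "x \<in> torus_subst \<chi> \<mu> ` hyp_class F p" if "F dvd x - torus_subst \<chi> \<mu> p" for x
  proof (rule image_eqI)
    show "x = torus_subst \<chi> \<mu> (torus_subst \<chi> (inverse \<mu>) x)"
      using torus_subst_inverse[of "inverse \<mu>" \<chi> x] assms by simp
    show "torus_subst \<chi> (inverse \<mu>) x \<in> hyp_class F p"
      using dvd[OF that, of "inverse \<mu>"] assms
      by (simp add: hyp_class_eq torus_subst_diff torus_subst_inverse)
  qed
  moreover have "F dvd torus_subst \<chi> \<mu> x - torus_subst \<chi> \<mu> p" if "F dvd x - p" for x
    using dvd[OF that, of \<mu>] assms by (simp add: torus_subst_diff)
  ultimately show ?thesis by (auto simp: hyp_class_eq)
qed

lemma chart_torus_frac:
  assumes "\<mu> \<noteq> 0" "weighted_homogeneous \<chi> 0 F" "\<chi> Z = 0"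
  shows "chart_torus F \<chi> \<mu> (chart_frac F p n) = chart_frac F (torus_subst \<chi> \<mu> p) n"
proof -
  note cls = torus_subst_hyp_class[OF assms(1,2)]
  have Z: "torus_subst \<chi> \<mu> (Var Z ^ j) = Var Z ^ j" for j
    using weighted_homogeneous_power[OF weighted_homogeneous_Var[of \<chi> Z], of j] assms(3)
    by (simp add: torus_subst_invariant)
  have "torus_subst \<chi> \<mu> ` x \<in> carrier (hyp_ring F)" if "x \<in> carrier (hyp_ring F)" for x
    using that by (elim hyp_ring_carrierE) (simp add: cls hyp_class_simps)
  moreover have "torus_subst \<chi> \<mu> ` x \<in> z_powers F" if x: "x \<in> z_powers F" for x
  proof -
    obtain j where "x = hyp_class F (Var Z ^ j)" using x unfolding z_powers_def by blast
    then show ?thesis by (simp add: cls Z z_power_mem)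
  qed
  moreover have "torus_subst \<chi> \<mu> ` (x \<otimes>\<^bsub>hyp_ring F\<^esub> y) =
      (torus_subst \<chi> \<mu> ` x) \<otimes>\<^bsub>hyp_ring F\<^esub> (torus_subst \<chi> \<mu> ` y)"
    if "x \<in> carrier (hyp_ring F)" "y \<in> carrier (hyp_ring F)" for x y
    using that by (elim hyp_ring_carrierE) (simp add: cls hyp_class_simps torus_subst_mult assms(1))
  ultimately show ?thesis
    unfolding chart_torus_def chart_frac_def
    by (subst cring_localization.loc_map_frac[OF cring_localization_hyp_ring])
      (simp_all add: cls Z z_power_mem hyp_class_simps)
qed

section \<open>The substitution and its kernel\<close>

definition T :: "complex poly fract" where "T = Fract [:0, 1:] 1"

definition cst :: "complex \<Rightarrow> complex poly fract" where "cst c = Fract [:c:] 1"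

lemma cst_simps: "cst 0 = 0" "cst 1 = 1" "cst (a + b) = cst a + cst b" "cst (a * b) = cst a * cst b"
  by (simp_all add: cst_def Zero_fract_def One_fract_def one_pCons mult.commute)

lemma T_ne_0: "T \<noteq> 0"
  unfolding T_def by (rule Fract_ne_0) auto

lemma cst_ne_0: "c \<noteq> 0 \<Longrightarrow> cst c \<noteq> 0"
  unfolding cst_def by (rule Fract_ne_0) auto

lemma Fract_monom: "Fract (monom c i) 1 = cst c * T ^ i"
proof (induction i)
  case 0
  show ?case by (simp add: cst_def monom_0)
next
  case (Suc i)
  have "Fract (monom c (Suc i)) 1 = Fract (monom c i) 1 * T"
    by (simp add: T_def monom_Suc)
  then show ?case by (simp add: Suc algebra_simps)
qed

lemma Fract_sum: "Fract (\<Sum>i\<in>I. p i) 1 = (\<Sum>i\<in>I. Fract (p i) 1)" for p :: "'b \<Rightarrow> 'a::idom"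
proof -
  have add: "Fract (a + b) 1 = Fract a 1 + Fract b 1" for a b :: 'a by simp
  show ?thesis
    by (induction I rule: infinite_finite_induct) (simp_all add: Zero_fract_def add del: add_fract)
qed

lemma Fract_poly_expand: "Fract p 1 = (\<Sum>i\<le>degree p. cst (coeff p i) * T ^ i)"
  using Fract_sum[of "\<lambda>i. monom (coeff p i) i" "{..degree p}"]
  by (simp add: poly_as_sum_of_monoms Fract_monom)

text \<open>Multiplying by \<open>T ^ E\<close>, with \<open>E\<close> an upper bound of all
  exponents, gives a polynomial identity in which distinct \<open>e i\<close> occupy distinct
  coefficients.\<close>

lemma T_powers_independent:
  assumes "finite I" "inj_on e I" "(\<Sum>i\<in>I. cst (c i) * inverse T ^ e i) = 0" "i \<in> I"
  shows "c i = 0"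
proof -
  define E where "E = (\<Sum>i\<in>I. e i)"
  have E: "e i \<le> E" if "i \<in> I" for i
    unfolding E_def using that assms(1) by (simp add: member_le_sum)
  have "Fract (\<Sum>i\<in>I. monom (c i) (E - e i)) 1 = (\<Sum>i\<in>I. cst (c i) * T ^ (E - e i))"
    by (simp add: Fract_sum Fract_monom)
  also have "\<dots> = (\<Sum>i\<in>I. cst (c i) * inverse T ^ e i) * T ^ E"
    unfolding sum_distrib_right
    by (intro sum.cong refl) (simp add: E power_diff T_ne_0 power_inverse divide_inverse)
  finally have "Fract (\<Sum>i\<in>I. monom (c i) (E - e i)) 1 = 0"
    using assms(3) by simp
  then have "(\<Sum>i\<in>I. monom (c i) (E - e i)) = 0"
    by (simp add: Zero_fract_def eq_fract)
  then have "(\<Sum>j\<in>I. coeff (monom (c j) (E - e j)) (E - e i)) = 0"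
    by (metis coeff_sum coeff_0)
  also have "(\<Sum>j\<in>I. coeff (monom (c j) (E - e j)) (E - e i)) = (\<Sum>j\<in>I. if j = i then c i else 0)"
  proof (intro sum.cong refl)
    fix j assume "j \<in> I"
    then have "E - e j = E - e i \<longleftrightarrow> j = i"
      using E[of j] E[of i] assms(2,4) by (auto simp: inj_on_def)
    then show "coeff (monom (c j) (E - e j)) (E - e i) = (if j = i then c i else 0)" by simp
  qed
  also have "\<dots> = c i" using assms(1,4) by simp
  finally show ?thesis .
qed

lemma single_sum: "Poly_Mapping.single m (\<Sum>i\<in>I. a i) = (\<Sum>i\<in>I. Poly_Mapping.single m (a i))"
  by (induction I rule: infinite_finite_induct) (simp_all add: single_add)

text \<open>\<open>e_sum\<close> is what \<open>D_+ + D_- \<le> 0\<close> says at the origin, given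
  \<open>D0_0\<close>. It keeps \<open>nat\<close> from truncating in
  \<open>hyp_poly\<close>.\<close>

locale hypersurface =
  fixes d k :: nat and e\<^sub>p e\<^sub>m :: int and Q :: "complex poly" and D\<^sub>0 :: "complex \<Rightarrow> int"
    and D\<^sub>p D\<^sub>m :: "complex \<Rightarrow> rat"
  assumes d_pos: "d \<ge> 1" and k_pos: "k \<ge> 1" and ep_pos: "0 < e\<^sub>p" and e_sum: "0 \<le> e\<^sub>p + e\<^sub>m"
    and Q_ne_0: "Q \<noteq> 0" and D0_def: "D\<^sub>0 = div_fract (Fract Q 1)" and D0_0: "D\<^sub>0 0 = 0"
    and cond: "k = 1 \<or> (e\<^sub>p + e\<^sub>m = 0 \<and> reduced_divisor D\<^sub>0)"
    and Dp_def: "D\<^sub>p = (\<lambda>c. - (of_int e\<^sub>p / of_nat d) * point_divisor 0 c)"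
    and Dm_def: "D\<^sub>m = (\<lambda>c. - (of_int e\<^sub>m / of_nat d) * point_divisor 0 c - 1 / of_nat k * of_int (D\<^sub>0 c))"
begin

abbreviation "F \<equiv> hyp_poly e\<^sub>p e\<^sub>m d k Q"
abbreviation "w \<equiv> hyp_weight e\<^sub>p e\<^sub>m d k Q"
abbreviation "\<chi> \<equiv> hyp_character k"

section \<open>The equation \<open>F\<close> and its two gradings\<close>

definition "q = degree Q"

definition "G = Var S ^ nat (int k * (e\<^sub>p + e\<^sub>m)) *
  (\<Sum>i\<le>q. Const (coeff Q i) * (Var S ^ d) ^ i * Var Z ^ (q - i))"

lemma F_eq: "F = Var X ^ k * Var Y - G"
  by (simp add: hyp_poly_def G_def q_def)

text \<open>All products \<open>(s^d)^i z^(q-i)\<close> have the same degree once \<open>z\<close>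
  and \<open>s^d\<close> do. The weight is left general because three are needed: \<open>w\<close>,
  the character \<open>\<chi>\<close>, and the one counting factors \<open>y\<close>.\<close>

lemma G_homogeneous:
  assumes "v Z = int d * v S"
  shows "weighted_homogeneous v (int (nat (int k * (e\<^sub>p + e\<^sub>m))) * v S + int q * v Z) G"
  unfolding G_def
proof (rule weighted_homogeneous_mult[OF weighted_homogeneous_power[OF weighted_homogeneous_Var]
      weighted_homogeneous_sum])
  fix i assume i: "i \<in> {..q}"
  have "weighted_homogeneous v (0 + int i * (int d * v S) + int (q - i) * v Z)
      (Const (coeff Q i) * (Var S ^ d) ^ i * Var Z ^ (q - i))"
    by (intro weighted_homogeneous_mult weighted_homogeneous_power weighted_homogeneous_Var
        weighted_homogeneous_Const)
  moreover have "0 + int i * (int d * v S) + int (q - i) * v Z = int q * v Z"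
    using i by (simp add: of_nat_diff assms algebra_simps)
  ultimately show "weighted_homogeneous v (int q * v Z)
      (Const (coeff Q i) * (Var S ^ d) ^ i * Var Z ^ (q - i))" by simp
qed

lemma XY_homogeneous: "weighted_homogeneous v (int k * v X + v Y) (Var X ^ k * Var Y)"
  by (intro weighted_homogeneous_mult weighted_homogeneous_power weighted_homogeneous_Var)

definition "wF = int k * (e\<^sub>p + e\<^sub>m) + int q * int d"

lemma w_simps: "w X = e\<^sub>p" "w Y = int k * e\<^sub>m + int d * int q" "w Z = int d" "w S = 1"
  by (simp_all add: hyp_weight_def q_def)

lemma \<chi>_simps: "\<chi> X = 1" "\<chi> Y = - int k" "\<chi> Z = 0" "\<chi> S = 0"
  by (simp_all add: hyp_character_def)

lemma G_weight: "weighted_homogeneous w wF G"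
  using G_homogeneous[of w] e_sum by (simp add: w_simps wF_def)

lemma F_weight: "weighted_homogeneous w wF F"
  using weighted_homogeneous_diff[OF _ G_weight, of "Var X ^ k * Var Y"] XY_homogeneous[of w]
  by (simp add: F_eq w_simps wF_def algebra_simps)

lemma F_invariant: "weighted_homogeneous \<chi> 0 F"
  using weighted_homogeneous_diff[OF XY_homogeneous[of \<chi>], of G] G_homogeneous[of \<chi>]
  by (simp add: F_eq \<chi>_simps)

lemma G_no_Y: "m \<in> Poly_Mapping.keys G \<Longrightarrow> Poly_Mapping.lookup m Y = 0"
  \<comment> \<open>For this weight \<open>G\<close> is homogeneous of degree 0, and the degree of a
    monomial is its exponent of \<open>y\<close>.\<close>
  using G_homogeneous[of "\<lambda>v. if v = Y then 1 else 0"]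
  by (auto simp: weighted_homogeneous_def weighted_degree_expand)

section \<open>The substitution into Laurent polynomials\<close>

definition "Qf = Fract Q 1"

text \<open>The image of a monomial without its power of \<open>u\<close>, which \<open>udeg\<close>
  records. The exponent of \<open>s\<close> is absent since \<open>s\<close> goes to 1.\<close>

definition val :: "(var \<Rightarrow>\<^sub>0 nat) \<Rightarrow> complex poly fract" where
  "val m = Qf ^ Poly_Mapping.lookup m Y * inverse T ^ (q * Poly_Mapping.lookup m Y + Poly_Mapping.lookup m Z)"

definition udeg :: "(var \<Rightarrow>\<^sub>0 nat) \<Rightarrow> int" where
  "udeg m = int (Poly_Mapping.lookup m X) - int k * int (Poly_Mapping.lookup m Y)"

definition \<phi> :: "mpoly4 \<Rightarrow> laurent" where
  "\<phi> = pm_extend (\<lambda>m c. Poly_Mapping.single (udeg m) (cst c * val m))"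

lemma Qf_ne_0: "Qf \<noteq> 0"
  unfolding Qf_def using Q_ne_0 by (intro Fract_ne_0) auto

lemma \<phi>_0: "\<phi> 0 = 0"
  by (simp add: \<phi>_def pm_extend_def)

lemma \<phi>_add: "\<phi> (p + p') = \<phi> p + \<phi> p'"
  unfolding \<phi>_def by (rule pm_extend_add) (simp_all add: cst_simps single_add algebra_simps)

lemma \<phi>_diff: "\<phi> (p - p') = \<phi> p - \<phi> p'"
  using \<phi>_add[of "p - p'" p'] by simp

lemma \<phi>_sum: "\<phi> (\<Sum>i\<in>I. p i) = (\<Sum>i\<in>I. \<phi> (p i))"
  by (induction I rule: infinite_finite_induct) (simp_all add: \<phi>_0 \<phi>_add)

lemma \<phi>_single: "\<phi> (Poly_Mapping.single m c) = Poly_Mapping.single (udeg m) (cst c * val m)"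
  unfolding \<phi>_def by (rule pm_extend_single) (simp_all add: cst_simps single_add algebra_simps)

lemma udeg_add: "udeg (m + n) = udeg m + udeg n"
  by (simp add: udeg_def lookup_add algebra_simps)

lemma val_add: "val (m + n) = val m * val n"
  by (simp add: val_def lookup_add power_add algebra_simps)

lemma \<phi>_mult: "\<phi> (p * p') = \<phi> p * \<phi> p'"
  unfolding \<phi>_def
  by (rule pm_extend_mult)
    (simp_all add: cst_simps single_add mult_single udeg_add val_add algebra_simps)

lemma \<phi>_Const: "\<phi> (Const c) = Poly_Mapping.single 0 (cst c)"
  by (simp add: Const_def \<phi>_single udeg_def val_def)

lemma \<phi>_X_power: "\<phi> (Var X ^ n) = Poly_Mapping.single (int n) 1"
  and \<phi>_Y_power: "\<phi> (Var Y ^ n) = Poly_Mapping.single (- int k * int n) (Qf ^ n * inverse T ^ (q * n))"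
  and \<phi>_Z_power: "\<phi> (Var Z ^ n) = Poly_Mapping.single 0 (inverse T ^ n)"
  and \<phi>_S_power: "\<phi> (Var S ^ n) = 1"
  by (simp_all add: Var_power \<phi>_single udeg_def val_def lookup_single cst_simps)

lemma \<phi>_F: "\<phi> F = 0"
proof -
  have S: "\<phi> ((Var S ^ d) ^ i) = 1" for i
    by (simp add: \<phi>_S_power flip: power_mult)
  have "\<phi> G = (\<Sum>i\<le>q. Poly_Mapping.single 0 (cst (coeff Q i) * inverse T ^ (q - i)))"
    by (simp add: G_def \<phi>_mult \<phi>_sum \<phi>_S_power S \<phi>_Const \<phi>_Z_power mult_single)
  also have "\<dots> = Poly_Mapping.single 0 (\<Sum>i\<le>q. cst (coeff Q i) * inverse T ^ (q - i))"
    by (rule single_sum[symmetric])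
  \<comment> \<open>Under the substitution \<open>s^d/z\<close> becomes \<open>t\<close>, so the sum
    is \<open>Q(t)\<close> times the image \<open>t^(-q)\<close> of \<open>z^q\<close>.\<close>
  also have "(\<Sum>i\<le>q. cst (coeff Q i) * inverse T ^ (q - i)) = Qf * inverse T ^ q"
    unfolding Qf_def Fract_poly_expand q_def[symmetric] sum_distrib_right
    by (intro sum.cong refl) (simp add: power_diff T_ne_0 power_inverse field_simps)
  also have "Poly_Mapping.single 0 \<dots> = \<phi> (Var X ^ k * Var Y)"
    using \<phi>_Y_power[of 1] by (simp add: \<phi>_mult \<phi>_X_power mult_single)
  finally show ?thesis by (simp add: F_eq \<phi>_diff)
qed

section \<open>Normal forms modulo \<open>F\<close> and the kernel\<close>

definition normal :: "mpoly4 \<Rightarrow> bool" where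
  "normal p \<longleftrightarrow> (\<forall>m\<in>Poly_Mapping.keys p. Poly_Mapping.lookup m X < k \<or> Poly_Mapping.lookup m Y = 0)"

text \<open>The weighted degree is kept under reduction because \<open>normal_kernel\<close>
  recovers the exponent of \<open>s\<close> from it.\<close>

definition reducible_to :: "int \<Rightarrow> mpoly4 set" where
  "reducible_to N = {p. \<exists>p'. normal p' \<and> weighted_homogeneous w N p' \<and> F dvd p - p'}"

lemma normal_add: "normal p \<Longrightarrow> normal p' \<Longrightarrow> normal (p + p')"
  unfolding normal_def using Poly_Mapping.keys_add[of p p'] by (meson UnE subsetD)

lemma reducible_to_0: "0 \<in> reducible_to N"
  by (auto simp: reducible_to_def normal_def weighted_homogeneous_0 intro!: exI[of _ 0])

lemma reducible_to_add:
  assumes "p \<in> reducible_to N" "p' \<in> reducible_to N"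
  shows "p + p' \<in> reducible_to N"
proof -
  obtain r r' where r: "normal r" "weighted_homogeneous w N r" "F dvd p - r"
    "normal r'" "weighted_homogeneous w N r'" "F dvd p' - r'"
    using assms by (auto simp: reducible_to_def)
  have "F dvd (p + p') - (r + r')" using dvd_add[OF r(3,6)] by (simp add: algebra_simps)
  then show ?thesis
    unfolding reducible_to_def using r normal_add weighted_homogeneous_add by blast
qed

lemma reducible_to_sum: "(\<And>i. i \<in> I \<Longrightarrow> p i \<in> reducible_to N) \<Longrightarrow> (\<Sum>i\<in>I. p i) \<in> reducible_to N"
  by (induction I rule: infinite_finite_induct) (auto simp: reducible_to_0 reducible_to_add)

lemma reducible_to_cong:
  assumes "p' \<in> reducible_to N" "F dvd p - p'"
  shows "p \<in> reducible_to N"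
proof -
  obtain r where r: "normal r" "weighted_homogeneous w N r" "F dvd p' - r"
    using assms by (auto simp: reducible_to_def)
  have "F dvd p - r" using dvd_add[OF assms(2) r(3)] by simp
  then show ?thesis using r by (auto simp: reducible_to_def)
qed

text \<open>Replacing \<open>x\<^sup>k y\<close> by \<open>G\<close> lowers the exponent of \<open>y\<close>, which does not occur in \<open>G\<close>.\<close>

lemma single_reducible:
  "weighted_degree w m = N \<Longrightarrow> Poly_Mapping.single m c \<in> reducible_to N"
proof (induction "Poly_Mapping.lookup m Y" arbitrary: m c rule: less_induct)
  case less
  show ?case
  proof (cases "Poly_Mapping.lookup m X < k \<or> Poly_Mapping.lookup m Y = 0")
    case True
    then have "normal (Poly_Mapping.single m c)" by (cases "c = 0") (auto simp: normal_def)
    then show ?thesis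
      using weighted_homogeneous_single[of w m N] less.prems
      by (auto simp: reducible_to_def intro!: exI[of _ "Poly_Mapping.single m c"])
  next
    case False
    \<comment> \<open>\<open>n\<close> is the monomial \<open>x^k y\<close>. Failure of the
      normality condition makes it divide \<open>m\<close>, so the truncated subtraction in
      \<open>m'\<close> is exact.\<close>
    define n where "n = Poly_Mapping.single X k + Poly_Mapping.single Y (1::nat)"
    define m' where "m' = m - n"
    have m: "m = m' + n"
      unfolding m'_def n_def
      by (rule poly_mapping_eqI) (use False in \<open>auto simp: lookup_add lookup_minus lookup_single when_def\<close>)
    have XY: "Var X ^ k * Var Y = Poly_Mapping.single n 1"
      unfolding n_def Var_power[of X] using Var_power[of Y 1] by (simp add: mult_single)
    have F: "F = Poly_Mapping.single n 1 - G" by (simp add: F_eq XY)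
    have "weighted_degree w n = wF"
      by (simp add: n_def weighted_degree_expand lookup_add lookup_single w_simps wF_def algebra_simps)
    then have N: "N = weighted_degree w m' + wF"
      using less.prems by (simp add: m weighted_degree_add)
    have hom: "weighted_homogeneous w N (Poly_Mapping.single m' c * G)"
      unfolding N by (intro weighted_homogeneous_mult weighted_homogeneous_single G_weight refl)
    have "Poly_Mapping.single x a \<in> reducible_to N"
      if x: "x \<in> Poly_Mapping.keys (Poly_Mapping.single m' c * G)" for x a
    proof (rule less.hyps)
      obtain g where g: "g \<in> Poly_Mapping.keys G" "x = m' + g"
        using x Poly_Mapping.keys_mult[of "Poly_Mapping.single m' c" G] by (auto split: if_splits)
      show "Poly_Mapping.lookup x Y < Poly_Mapping.lookup m Y"
        using G_no_Y[OF g(1)] by (simp add: g(2) m n_def lookup_add lookup_single)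
      show "weighted_degree w x = N" using hom x by (auto simp: weighted_homogeneous_def)
    qed
    then have "Poly_Mapping.single m' c * G \<in> reducible_to N"
      using reducible_to_sum[of "Poly_Mapping.keys (Poly_Mapping.single m' c * G)"
          "\<lambda>x. Poly_Mapping.single x (Poly_Mapping.lookup (Poly_Mapping.single m' c * G) x)" N]
      by (simp add: poly_mapping_sum_single)
    moreover have "Poly_Mapping.single m c - Poly_Mapping.single m' c * G = F * Poly_Mapping.single m' c"
      by (simp add: F m algebra_simps mult_single)
    ultimately show ?thesis by (metis reducible_to_cong dvd_triv_left)
  qed
qed

lemma homogeneous_reducible:
  assumes "weighted_homogeneous w N p"
  shows "p \<in> reducible_to N"
  using reducible_to_sum[of "Poly_Mapping.keys p" "\<lambda>m. Poly_Mapping.single m (Poly_Mapping.lookup p m)" N]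
    single_reducible assms
  by (auto simp: poly_mapping_sum_single weighted_homogeneous_def)

text \<open>If \<open>b < b'\<close>, then \<open>a' = a + k (b' - b)\<close> is at least
  \<open>k\<close> while \<open>b' > 0\<close>, against the condition on the second pair; the other
  case is symmetric.\<close>

lemma normal_exponents_unique:
  fixes a b a' b' :: nat
  assumes "int a - int k * int b = int a' - int k * int b'" "a < k \<or> b = 0" "a' < k \<or> b' = 0"
  shows "a = a'" "b = b'"
proof -
  have le: "\<not> y < y'" if "int x - int k * int y = int x' - int k * int y'" "x' < k \<or> y' = 0" for x y x' y' :: nat
  proof
    assume "y < y'"
    then have "int k * 1 \<le> int k * (int y' - int y)" by (intro mult_left_mono) auto
    then show False using that \<open>y < y'\<close> by (auto simp: algebra_simps)
  qed
  show "b = b'" using le[OF assms(1,3)] le[OF assms(1)[symmetric] assms(2)] by simp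
  then show "a = a'" using assms(1) by simp
qed

lemma normal_kernel:
  assumes "normal p" "weighted_homogeneous w N p" "\<phi> p = 0"
  shows "p = 0"
proof (rule ccontr)
  assume "p \<noteq> 0"
  then obtain m where m: "m \<in> Poly_Mapping.keys p" by fastforce
  define K where "K = {n \<in> Poly_Mapping.keys p. udeg n = udeg m}"
  let ?y = "Poly_Mapping.lookup m Y" and ?c = "Poly_Mapping.lookup p"
  have XY: "Poly_Mapping.lookup n X = Poly_Mapping.lookup m X" "Poly_Mapping.lookup n Y = ?y"
    if "n \<in> K" for n
    using normal_exponents_unique[of "Poly_Mapping.lookup n X" "Poly_Mapping.lookup n Y"
        "Poly_Mapping.lookup m X" ?y] that m assms(1)
    by (auto simp: K_def udeg_def normal_def)
  have inj: "inj_on (\<lambda>n. Poly_Mapping.lookup n Z) K"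
  proof (rule inj_onI)
    fix n n' assume n: "n \<in> K" "n' \<in> K" "Poly_Mapping.lookup n Z = Poly_Mapping.lookup n' Z"
    then have "weighted_degree w n = weighted_degree w n'"
      using assms(2) by (auto simp: K_def weighted_homogeneous_def)
    then have "Poly_Mapping.lookup n S = Poly_Mapping.lookup n' S"
      using XY[OF n(1)] XY[OF n(2)] n(3) by (simp add: weighted_degree_expand w_simps)
    then have "Poly_Mapping.lookup n v = Poly_Mapping.lookup n' v" for v
      using XY[OF n(1)] XY[OF n(2)] n(3) by (cases v) simp_all
    then show "n = n'" by (rule poly_mapping_eqI)
  qed
  have "0 = Poly_Mapping.lookup (\<phi> p) (udeg m)" by (simp add: assms(3))
  also have "\<dots> = (\<Sum>n\<in>Poly_Mapping.keys p. if udeg n = udeg m then cst (?c n) * val n else 0)"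
    by (simp add: \<phi>_def pm_extend_def lookup_sum lookup_single when_def)
  also have "\<dots> = (\<Sum>n\<in>K. cst (?c n) * val n)"
    unfolding K_def by (simp add: sum.inter_filter)
  \<comment> \<open>The exponent of \<open>y\<close> is constant on \<open>K\<close>, so a nonzero
    factor comes out and distinct powers of \<open>1/t\<close> remain.\<close>
  also have "\<dots> = (Qf ^ ?y * inverse T ^ (q * ?y)) *
      (\<Sum>n\<in>K. cst (?c n) * inverse T ^ Poly_Mapping.lookup n Z)"
    unfolding sum_distrib_left by (intro sum.cong refl) (simp add: val_def XY power_add)
  finally have "(\<Sum>n\<in>K. cst (?c n) * inverse T ^ Poly_Mapping.lookup n Z) = 0"
    using Qf_ne_0 T_ne_0 by simp
  then have "?c m = 0"
    using T_powers_independent[OF _ inj, of ?c m] m by (simp add: K_def)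
  then show False using m by (simp add: in_keys_iff)
qed

text \<open>Homogeneity is essential: \<open>s - 1\<close> also goes to 0, but it is no multiple of
  \<open>F\<close>.\<close>

lemma kernel:
  assumes "weighted_homogeneous w N p" "\<phi> p = 0"
  shows "F dvd p"
proof -
  obtain r where r: "normal r" "weighted_homogeneous w N r" "F dvd p - r"
    using homogeneous_reducible[OF assms(1)] by (auto simp: reducible_to_def)
  then have "\<phi> (p - r) = 0" by (auto simp: dvd_def \<phi>_mult \<phi>_F)
  then have "\<phi> r = 0" using assms(2) by (simp add: \<phi>_diff)
  then show ?thesis using normal_kernel[OF r(1,2)] r(3) by simp
qed

end

section \<open>The image of the substitution\<close>

lemma divide_le_of_int_iff:
  assumes "d \<ge> 1"
  shows "(of_int x :: rat) / of_nat d \<le> of_int n \<longleftrightarrow> x \<le> int d * n"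
proof -
  have "(of_int x :: rat) / of_nat d \<le> of_int n \<longleftrightarrow> of_int x \<le> (of_int n * of_nat d :: rat)"
    using assms by (simp add: pos_divide_le_eq)
  also have "(of_int n * of_nat d :: rat) = of_int (int d * n)" by (simp add: mult.commute)
  finally show ?thesis by (simp only: of_int_le_iff)
qed

context hypersurface
begin

lemma D0_nonneg: "0 \<le> D\<^sub>0 c"
  unfolding D0_def using Q_ne_0 by (simp add: div_fract_Fract)

text \<open>Clearing the denominators \<open>d\<close> and \<open>k\<close> leaves integer
  inequalities. They separate into one at the origin, governed by \<open>e\<^sub>p\<close> or
  \<open>e\<^sub>m\<close>, and those elsewhere, because \<open>D\<^sub>0\<close> vanishes at
  0.\<close>

lemma piece_iff:
  assumes "f \<noteq> 0"
  shows "f \<in> DPD_piece D\<^sub>p D\<^sub>m i \<longleftrightarrow>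
    (if i \<ge> 0 then i * e\<^sub>p \<le> int d * div_fract f 0 \<and> (\<forall>c. c \<noteq> 0 \<longrightarrow> 0 \<le> div_fract f c)
     else - i * e\<^sub>m \<le> int d * div_fract f 0 \<and>
       (\<forall>c. c \<noteq> 0 \<longrightarrow> - i * D\<^sub>0 c \<le> int k * div_fract f c))"
proof -
  note div_le = divide_le_of_int_iff[symmetric]
  have nonneg: "0 \<le> x + y \<longleftrightarrow> - y \<le> x" for x y :: rat by linarith
  have at: "(0::rat) \<le> of_int (div_fract f c) + (if i \<ge> 0 then of_int i * D\<^sub>p c else of_int (- i) * D\<^sub>m c) \<longleftrightarrow>
    (if c = 0 then (if i \<ge> 0 then i * e\<^sub>p else - i * e\<^sub>m) \<le> int d * div_fract f c
     else if i \<ge> 0 then 0 \<le> div_fract f c else - i * D\<^sub>0 c \<le> int k * div_fract f c)" for c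
    unfolding Dp_def Dm_def point_divisor_def
    by (simp add: div_le[OF d_pos] div_le[OF k_pos] D0_0 nonneg)
  show ?thesis
    unfolding DPD_piece_def mem_Collect_eq at using assms by (cases "i \<ge> 0") auto
qed

lemma div_T_Qf:
  assumes "c \<noteq> 0"
  shows "div_fract (cst c * (T powi m * Qf ^ b)) x = (if x = 0 then m else int b * D\<^sub>0 x)"
proof -
  have "div_fract (cst c) x = 0" using assms by (simp add: cst_def div_fract_const)
  moreover have "div_fract (T powi m) x = (if x = 0 then m else 0)"
    using div_fract_powi[OF T_ne_0, of m x] by (simp add: T_def div_fract_T)
  moreover have "div_fract (Qf ^ b) x = int b * D\<^sub>0 x"
    using div_fract_power[OF Qf_ne_0, of b x] by (simp add: Qf_def D0_def)
  ultimately show ?thesis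
    using assms T_ne_0 Qf_ne_0 D0_0 cst_ne_0[of c] by (auto simp: div_fract_mult power_int_eq_0_iff)
qed

text \<open>Let \<open>i = a - k b\<close>. Then \<open>i e\<^sub>p\<close> and
  \<open>- i e\<^sub>m\<close> arise from \<open>a e\<^sub>p + k b e\<^sub>m\<close> by subtracting
  \<open>k b (e\<^sub>p + e\<^sub>m)\<close> and \<open>a (e\<^sub>p + e\<^sub>m)\<close>, both
  nonnegative by \<open>e_sum\<close>. So the bound at 0 holds for either sign of
  \<open>i\<close>.\<close>

lemma monomial_in_piece:
  assumes "int a * e\<^sub>p + int k * e\<^sub>m * int b \<le> int d * m"
  shows "cst c * (T powi m * Qf ^ b) \<in> DPD_piece D\<^sub>p D\<^sub>m (int a - int k * int b)"
proof (cases "c = 0")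
  case True
  then show ?thesis by (simp add: cst_simps DPD_piece_def)
next
  case False
  then have nz: "cst c * (T powi m * Qf ^ b) \<noteq> 0"
    using cst_ne_0[of c] T_ne_0 Qf_ne_0 by (simp add: power_int_eq_0_iff)
  have kb: "0 \<le> int k * int b * (e\<^sub>p + e\<^sub>m)" and ae: "0 \<le> int a * (e\<^sub>p + e\<^sub>m)"
    using e_sum by simp_all
  have "(int a - int k * int b) * e\<^sub>p \<le> int d * m" "- (int a - int k * int b) * e\<^sub>m \<le> int d * m"
    using assms kb ae by (simp_all add: algebra_simps)
  moreover have "- (int a - int k * int b) * D\<^sub>0 x \<le> int k * (int b * D\<^sub>0 x)" for x
    using D0_nonneg[of x] by (simp add: algebra_simps)
  ultimately show ?thesis
    using D0_nonneg by (simp add: piece_iff[OF nz] div_T_Qf[OF False])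
qed

section \<open>Values of the fractions \<open>p/z^n\<close>: the factor \<open>T ^ n\<close> inverts
  the image of \<open>z^n\<close>\<close>

definition \<beta> :: "mpoly4 \<Rightarrow> nat \<Rightarrow> laurent" where
  "\<beta> p n = Poly_Mapping.single 0 (T ^ n) * \<phi> p"

lemma \<beta>_0: "\<beta> 0 n = 0"
  by (simp add: \<beta>_def \<phi>_0)

lemma \<beta>_sum: "\<beta> (\<Sum>i\<in>I. p i) n = (\<Sum>i\<in>I. \<beta> (p i) n)"
  by (simp add: \<beta>_def \<phi>_sum sum_distrib_left)

lemma \<beta>_mult: "\<beta> (p * p') (n + n') = \<beta> p n * \<beta> p' n'"
proof -
  have "Poly_Mapping.single (0::int) (T ^ (n + n')) = Poly_Mapping.single 0 (T ^ n) * Poly_Mapping.single 0 (T ^ n')"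
    by (simp add: mult_single power_add)
  then show ?thesis by (simp add: \<beta>_def \<phi>_mult mult_ac)
qed

lemma \<beta>_Const: "\<beta> (Const c) 0 = Poly_Mapping.single 0 (cst c)"
  by (simp add: \<beta>_def \<phi>_Const mult_single)

lemma \<beta>_1: "\<beta> 1 0 = 1"
  using \<beta>_Const[of 1] by (simp add: Const_def cst_simps)

lemma \<beta>_Z_power: "\<beta> (Var Z ^ n) n = 1"
  by (simp add: \<beta>_def \<phi>_Z_power mult_single T_ne_0 power_inverse)

lemma \<beta>_add: "\<beta> (p * Var Z ^ n' + p' * Var Z ^ n) (n + n') = \<beta> p n + \<beta> p' n'"
  (is "?l = _")
proof -
  have "?l = \<beta> (p * Var Z ^ n') (n + n') + \<beta> (p' * Var Z ^ n) (n' + n)"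
    by (simp add: \<beta>_def \<phi>_add algebra_simps)
  then show ?thesis by (simp add: \<beta>_mult \<beta>_Z_power)
qed

lemma \<beta>_single:
  "\<beta> (Poly_Mapping.single m c) n = Poly_Mapping.single (udeg m) (cst c *
     (T powi (int n - int (q * Poly_Mapping.lookup m Y + Poly_Mapping.lookup m Z)) *
       Qf ^ Poly_Mapping.lookup m Y))"
proof -
  have "T powi (int i - int j) = T ^ i * inverse T ^ j" for i j
    using T_ne_0 by (simp add: power_int_diff power_inverse divide_inverse)
  then show ?thesis
    by (simp add: \<beta>_def \<phi>_single mult_single val_def mult_ac del: of_nat_add of_nat_mult)
qed

lemma \<beta>_expand:
  "\<beta> p n = (\<Sum>m\<in>Poly_Mapping.keys p. \<beta> (Poly_Mapping.single m (Poly_Mapping.lookup p m)) n)"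
  using \<beta>_sum[of "\<lambda>m. Poly_Mapping.single m (Poly_Mapping.lookup p m)" "Poly_Mapping.keys p" n]
  by (simp add: poly_mapping_sum_single)

definition hom_frac :: "mpoly4 \<Rightarrow> nat \<Rightarrow> bool" where
  "hom_frac p n \<longleftrightarrow> weighted_homogeneous w (int n * int d) p"

lemma hom_frac_Z_power: "hom_frac (Var Z ^ n) n"
  using weighted_homogeneous_power[OF weighted_homogeneous_Var[of w Z], of n]
  by (simp add: hom_frac_def w_simps)

lemma hom_frac_mult: "hom_frac p n \<Longrightarrow> hom_frac p' n' \<Longrightarrow> hom_frac (p * p') (n + n')"
  using weighted_homogeneous_mult[of w "int n * int d" p "int n' * int d" p']
  by (simp add: hom_frac_def algebra_simps)

lemma hom_frac_add:
  assumes "hom_frac p n" "hom_frac p' n'"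
  shows "hom_frac (p * Var Z ^ n' + p' * Var Z ^ n) (n + n')"
    and "hom_frac (p * Var Z ^ n' - p' * Var Z ^ n) (n + n')"
  using hom_frac_mult[OF assms(1) hom_frac_Z_power[of n']]
    hom_frac_mult[OF assms(2) hom_frac_Z_power[of n]]
  by (simp_all add: hom_frac_def weighted_homogeneous_add weighted_homogeneous_diff add.commute)

abbreviation "A \<equiv> DPD_ring D\<^sub>p D\<^sub>m"

lemma single_in_A: "g \<in> DPD_piece D\<^sub>p D\<^sub>m i \<Longrightarrow> Poly_Mapping.single i g \<in> carrier A"
  by (auto simp: DPD_ring_def ring_on_def lookup_single when_def DPD_piece_def)

text \<open>The exponent of \<open>s\<close> is nonnegative; dropping it from the degree equation
  leaves the inequality of \<open>monomial_in_piece\<close>.\<close>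

lemma \<beta>_single_in_A:
  assumes "weighted_degree w m = int n * int d"
  shows "\<beta> (Poly_Mapping.single m c) n \<in> carrier A"
  unfolding \<beta>_single
proof (rule single_in_A)
  let ?a = "Poly_Mapping.lookup m X" and ?b = "Poly_Mapping.lookup m Y"
    and ?e = "Poly_Mapping.lookup m Z"
  have "int ?a * e\<^sub>p + int k * e\<^sub>m * int ?b + int (Poly_Mapping.lookup m S) =
      int d * (int n - int (q * ?b + ?e))"
    using assms by (simp add: weighted_degree_expand w_simps algebra_simps)
  then have "int ?a * e\<^sub>p + int k * e\<^sub>m * int ?b \<le> int d * (int n - int (q * ?b + ?e))"
    by linarith
  then show "cst c * (T powi (int n - int (q * ?b + ?e)) * Qf ^ ?b) \<in> DPD_piece D\<^sub>p D\<^sub>m (udeg m)"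
    unfolding udeg_def by (rule monomial_in_piece)
qed

definition fractions :: "laurent set" where
  "fractions = {\<beta> p n | p n. hom_frac p n}"

lemma fractions_0: "0 \<in> fractions"
  using \<beta>_0[of 0] weighted_homogeneous_0 by (force simp: fractions_def hom_frac_def)

lemma fractions_add: "f \<in> fractions \<Longrightarrow> g \<in> fractions \<Longrightarrow> f + g \<in> fractions"
  unfolding fractions_def using \<beta>_add hom_frac_add(1) by (auto; metis)

lemma fractions_sum: "(\<And>i. i \<in> I \<Longrightarrow> f i \<in> fractions) \<Longrightarrow> (\<Sum>i\<in>I. f i) \<in> fractions"
  by (induction I rule: infinite_finite_induct) (auto simp: fractions_0 fractions_add)

text \<open>Reverses \<open>\<beta>_single_in_A\<close>: the slack of the inequality becomes the
  exponent of \<open>s\<close>.\<close>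

lemma monomial_in_fractions:
  assumes "int a * e\<^sub>p + int k * e\<^sub>m * int b \<le> int d * m"
  shows "Poly_Mapping.single (int a - int k * int b) (cst c * (T powi m * Qf ^ b)) \<in> fractions"
proof -
  \<comment> \<open>The order of \<open>t\<close> has to be \<open>m = n - q b - e\<close>. So
    \<open>n\<close> and \<open>e\<close> are the positive and the negative part of
    \<open>m + q b\<close>.\<close>
  define n where "n = nat (m + int q * int b)"
  define e where "e = nat (int n - m - int q * int b)"
  define s where "s = nat (int d * m - (int a * e\<^sub>p + int k * e\<^sub>m * int b))"
  define M where "M = Poly_Mapping.single X a + Poly_Mapping.single Y b +
    Poly_Mapping.single Z e + Poly_Mapping.single S s"
  have M: "Poly_Mapping.lookup M X = a" "Poly_Mapping.lookup M Y = b"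
    "Poly_Mapping.lookup M Z = e" "Poly_Mapping.lookup M S = s"
    by (simp_all add: M_def lookup_add lookup_single)
  have e: "int e = int n - m - int q * int b" by (simp add: e_def n_def)
  have s: "int s = int d * m - (int a * e\<^sub>p + int k * e\<^sub>m * int b)" using assms by (simp add: s_def)
  have "weighted_degree w M = int n * int d"
    by (simp add: weighted_degree_expand M w_simps e s algebra_simps)
  then have "hom_frac (Poly_Mapping.single M c) n"
    unfolding hom_frac_def by (rule weighted_homogeneous_single)
  moreover have "\<beta> (Poly_Mapping.single M c) n =
      Poly_Mapping.single (int a - int k * int b) (cst c * (T powi m * Qf ^ b))"
    by (simp add: \<beta>_single udeg_def M e)
  ultimately show ?thesis unfolding fractions_def by force
qed

text \<open>The quotient of \<open>f\<close> by \<open>T^m Q^b\<close> has no poles, hence is a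
  polynomial in \<open>t\<close>; each further power of \<open>t\<close> raises \<open>m\<close> and
  only relaxes the inequality.\<close>

lemma multiple_in_fractions:
  assumes "int a * e\<^sub>p + int k * e\<^sub>m * int b \<le> int d * m" and f: "f \<noteq> 0"
    and div: "m \<le> div_fract f 0" "\<And>x. x \<noteq> 0 \<Longrightarrow> int b * D\<^sub>0 x \<le> div_fract f x"
  shows "Poly_Mapping.single (int a - int k * int b) f \<in> fractions"
proof -
  define g where "g = T powi m * Qf ^ b"
  have g: "g \<noteq> 0" using T_ne_0 Qf_ne_0 by (simp add: g_def power_int_eq_0_iff)
  have "div_fract (f * inverse g) x = div_fract f x - (if x = 0 then m else int b * D\<^sub>0 x)" for x
    using div_T_Qf[of 1 m b x] f g
    by (simp add: div_fract_mult div_fract_inverse cst_simps flip: g_def)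
  then have "\<forall>x. 0 \<le> div_fract (f * inverse g) x" using div by simp
  then obtain p where p: "f * inverse g = Fract p 1" using polynomial_of_div_nonneg by blast
  have "f = g * Fract p 1" using g by (simp flip: p)
  also have "\<dots> = (\<Sum>j\<le>degree p. cst (coeff p j) * (T powi (m + int j) * Qf ^ b))"
    unfolding Fract_poly_expand sum_distrib_left g_def
    by (intro sum.cong refl) (simp add: power_int_add T_ne_0)
  finally have "Poly_Mapping.single (int a - int k * int b) f =
      (\<Sum>j\<le>degree p. Poly_Mapping.single (int a - int k * int b) (cst (coeff p j) * (T powi (m + int j) * Qf ^ b)))"
    by (simp only: single_sum)
  also have "\<dots> \<in> fractions"
  proof (intro fractions_sum monomial_in_fractions)
    fix j :: nat
    have "int d * m \<le> int d * (m + int j)" by (intro mult_left_mono) auto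
    then show "int a * e\<^sub>p + int k * e\<^sub>m * int b \<le> int d * (m + int j)" using assms(1) by linarith
  qed
  finally show ?thesis .
qed

text \<open>Here \<open>cond\<close> enters: every element of the piece has to be a multiple of
  \<open>T^m Q^b\<close> for one fixed choice of \<open>a\<close> and \<open>b\<close>, with
  \<open>m\<close> its order at 0.\<close>

lemma piece_in_fractions:
  assumes "f \<in> DPD_piece D\<^sub>p D\<^sub>m i" "f \<noteq> 0"
  shows "Poly_Mapping.single i f \<in> fractions"
proof (cases "i \<ge> 0")
  case True
  \<comment> \<open>In degrees \<open>i \<ge> 0\<close> the power \<open>x^i\<close> suffices, so
    \<open>b = 0\<close>.\<close>
  then show ?thesis
    using multiple_in_fractions[of "nat i" 0 "div_fract f 0" f] assms piece_iff[OF assms(2), of i] by simp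
next
  case False
  define N where "N = nat (- i)"
  \<comment> \<open>This is \<open>N/k\<close> rounded up, the least number of factors
    \<open>y\<close> that brings the degree in \<open>u\<close> down to \<open>-N\<close> or below;
    \<open>x^a\<close> corrects the remainder, so \<open>a < k\<close>.\<close>
  define b where "b = (N + k - 1) div k"
  define a where "a = k * b - N"
  have "N + k - 1 < k * Suc b" "k * b \<le> N + k - 1"
    using k_pos dividend_less_times_div[of k "N + k - 1"] times_div_less_eq_dividend[of k "N + k - 1"]
    by (simp_all add: b_def)
  then have N: "N \<le> k * b" "k * b < N + k" using k_pos by auto
  then have a: "int a - int k * int b = i" "int a < int k"
    using False by (auto simp: a_def N_def of_nat_diff simp flip: of_nat_mult)
  have piece: "int N * e\<^sub>m \<le> int d * div_fract f 0"
      "\<And>x. x \<noteq> 0 \<Longrightarrow> int N * D\<^sub>0 x \<le> int k * div_fract f x"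
    using assms piece_iff[OF assms(2), of i] False by (auto simp: N_def)
  have "Poly_Mapping.single (int a - int k * int b) f \<in> fractions"
  proof (rule multiple_in_fractions[OF _ assms(2) order.refl])
    \<comment> \<open>For \<open>k = 1\<close> the bound \<open>a < k\<close> forces
      \<open>a = 0\<close>; otherwise the other factor vanishes.\<close>
    have "int a * (e\<^sub>p + e\<^sub>m) = 0" using cond a by auto
    moreover have "int a * e\<^sub>p + int k * e\<^sub>m * int b = int a * (e\<^sub>p + e\<^sub>m) + int N * e\<^sub>m"
      using a(1) False by (simp add: N_def algebra_simps flip: a(1))
    ultimately show "int a * e\<^sub>p + int k * e\<^sub>m * int b \<le> int d * div_fract f 0"
      using piece(1) by linarith
    fix x :: complex assume x: "x \<noteq> 0"
    show "int b * D\<^sub>0 x \<le> div_fract f x"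
    proof (cases "k = 1")
      case True
      then show ?thesis using piece(2)[OF x] by (simp add: b_def)
    next
      case k: False
      then have "D\<^sub>0 x \<in> {0, 1}" using cond by (auto simp: reduced_divisor_def)
      moreover have "int b \<le> div_fract f x" if "D\<^sub>0 x = 1"
      proof -
        \<comment> \<open>The order at \<open>x\<close> is an integer not below \<open>N/k\<close>,
          so it is not below \<open>N/k\<close> rounded up.\<close>
        have "int k * int b < int k * (div_fract f x + 1)"
          using piece(2)[OF x] that N(2) by (simp add: algebra_simps flip: of_nat_mult)
        then show ?thesis using k_pos by simp
      qed
      moreover have "0 \<le> div_fract f x" if "D\<^sub>0 x = 0"
        using piece(2)[OF x] that k_pos by (simp add: zero_le_mult_iff)
      ultimately show ?thesis by auto
    qed
  qed
  then show ?thesis by (simp add: a(1))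
qed

text \<open>That \<open>A\<close> is a ring gives its closure under sums, so the inclusion of
  \<open>fractions\<close> in \<open>A\<close> needs checking on single terms only.\<close>

lemma A_eq_fractions:
  assumes "cring A"
  shows "carrier A = fractions"
proof (intro subset_antisym subsetI)
  fix f assume f: "f \<in> carrier A"
  have "(\<Sum>i\<in>Poly_Mapping.keys f. Poly_Mapping.single i (Poly_Mapping.lookup f i)) \<in> fractions"
    using f by (intro fractions_sum piece_in_fractions) (auto simp: DPD_ring_def ring_on_def in_keys_iff)
  then show "f \<in> fractions" by (simp add: poly_mapping_sum_single)
next
  interpret A: cring A by fact
  have add: "f + g \<in> carrier A" if "f \<in> carrier A" "g \<in> carrier A" for f g
    using A.a_closed[OF that] by (simp add: DPD_ring_def ring_on_def)
  have zero: "0 \<in> carrier A"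
    using A.zero_closed by (simp add: DPD_ring_def ring_on_def)
  have sum: "(\<Sum>i\<in>I. g i) \<in> carrier A" if "\<And>i. i \<in> I \<Longrightarrow> g i \<in> carrier A"
    for I :: "(var \<Rightarrow>\<^sub>0 nat) set" and g
    using that by (induction I rule: infinite_finite_induct) (auto simp: zero add)
  fix f assume "f \<in> fractions"
  then obtain p n where f: "f = \<beta> p n" "hom_frac p n" by (auto simp: fractions_def)
  then show "f \<in> carrier A"
    unfolding f(1) \<beta>_expand[of p]
    by (intro sum \<beta>_single_in_A) (auto simp: hom_frac_def weighted_homogeneous_def)
qed

text \<open>Gives well-definedness and injectivity at once. Forwards, \<open>\<phi>\<close> kills
  \<open>F\<close> and sends \<open>z\<close> to a unit, so the witness \<open>z^j\<close> cancels;
  backwards, \<open>kernel\<close> applies and \<open>z^0\<close> is a witness.\<close>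

lemma chart_frac_eq_iff_\<beta>:
  assumes "hom_frac p n" "hom_frac p' n'"
  shows "chart_frac F p n = chart_frac F p' n' \<longleftrightarrow> \<beta> p n = \<beta> p' n'"
proof -
  let ?r = "p * Var Z ^ n' - p' * Var Z ^ n"
  have diff: "\<beta> ?r (n + n') = \<beta> p n - \<beta> p' n'"
  proof -
    have "\<beta> ?r (n + n') = \<beta> (p * Var Z ^ n') (n + n') - \<beta> (p' * Var Z ^ n) (n' + n)"
      by (simp add: \<beta>_def \<phi>_diff right_diff_distrib add.commute)
    then show ?thesis by (simp only: \<beta>_mult \<beta>_Z_power mult_1_right)
  qed
  have unit: "Poly_Mapping.single (0::int) (inverse T ^ j) * Poly_Mapping.single 0 (T ^ j) = 1" for j
    using T_ne_0 by (simp add: mult_single power_inverse)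
  have \<phi>_zero: "\<phi> p = 0" if "\<beta> p j = 0" for p j
  proof -
    have "\<phi> p = Poly_Mapping.single 0 (inverse T ^ j) * \<beta> p j"
      unfolding \<beta>_def by (simp add: unit flip: mult.assoc)
    then show ?thesis using that by simp
  qed
  show ?thesis
  proof
    assume "chart_frac F p n = chart_frac F p' n'"
    then obtain j r where "Var Z ^ j * ?r = F * r" by (auto simp: chart_frac_eq_iff dvd_def)
    then have "\<phi> (Var Z ^ j * ?r) = 0" by (simp only: \<phi>_mult \<phi>_F mult_zero_left)
    then have "\<beta> (Var Z ^ j * ?r) (j + (n + n')) = 0" by (simp add: \<beta>_def)
    then show "\<beta> p n = \<beta> p' n'" by (simp add: \<beta>_mult[of _ ?r] \<beta>_Z_power diff)
  next
    assume "\<beta> p n = \<beta> p' n'"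
    then have "\<phi> ?r = 0" using \<phi>_zero[of ?r "n + n'"] diff by simp
    then have "F dvd ?r" using kernel hom_frac_add(2)[OF assms] by (simp add: hom_frac_def)
    then show "chart_frac F p n = chart_frac F p' n'"
      unfolding chart_frac_eq_iff by (auto intro!: exI[of _ 0])
  qed
qed

section \<open>Equivariance and the final isomorphism\<close>

lemma lookup_DPD_torus:
  "Poly_Mapping.lookup (DPD_torus \<mu> f) i = cst (\<mu> powi i) * Poly_Mapping.lookup f i"
  by (simp add: DPD_torus_def lookup_mapp when_def in_keys_iff cst_def)

text \<open>The weights of \<open>\<chi>\<close> are the exponents of \<open>u\<close> in the images
  of the variables, so both tori scale a term by the same factor.\<close>

lemma \<beta>_torus:
  assumes "\<mu> \<noteq> 0"
  shows "\<beta> (torus_subst \<chi> \<mu> p) n = DPD_torus \<mu> (\<beta> p n)"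
proof -
  have udeg: "weighted_degree \<chi> m = udeg m" for m
    by (simp add: weighted_degree_expand \<chi>_simps udeg_def)
  have sum: "DPD_torus \<mu> (\<Sum>i\<in>I. g i) = (\<Sum>i\<in>I. DPD_torus \<mu> (g i))" for I :: "(var \<Rightarrow>\<^sub>0 nat) set" and g
    by (rule poly_mapping_eqI) (simp add: lookup_DPD_torus lookup_sum sum_distrib_left)
  have single: "\<beta> (Poly_Mapping.single m (\<mu> powi weighted_degree \<chi> m * c)) n =
      DPD_torus \<mu> (\<beta> (Poly_Mapping.single m c) n)" for m c
    by (rule poly_mapping_eqI)
      (simp add: lookup_DPD_torus \<beta>_single lookup_single when_def cst_simps udeg)
  have "\<beta> (torus_subst \<chi> \<mu> p) n = (\<Sum>m\<in>Poly_Mapping.keys p.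
      \<beta> (Poly_Mapping.single m (\<mu> powi weighted_degree \<chi> m * Poly_Mapping.lookup p m)) n)"
    by (simp add: torus_subst_pm_extend[OF assms] pm_extend_def \<beta>_sum)
  also have "\<dots> = DPD_torus \<mu> (\<beta> p n)" unfolding single \<beta>_expand[of p] sum ..
  finally show ?thesis .
qed

theorem equivariantly_isomorphic_chart:
  assumes "cring A"
  shows "equivariantly_isomorphic (DPD_Spec D\<^sub>p D\<^sub>m) (DPD_action D\<^sub>p D\<^sub>m)
    (D_plus_z F w) (D_plus_z_action F w \<chi>)"
proof -
  \<comment> \<open>\<open>h\<close> inverts the passage from \<open>p/z^n\<close> to its value; by
    \<open>chart_frac_eq_iff_\<beta>\<close> the choice of \<open>p\<close> and \<open>n\<close>
    does not matter.\<close>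
  define h where "h f = (let pn = SOME pn. hom_frac (fst pn) (snd pn) \<and> \<beta> (fst pn) (snd pn) = f
    in chart_frac F (fst pn) (snd pn))" for f
  have h: "h (\<beta> p n) = chart_frac F p n" if "hom_frac p n" for p n
  proof -
    let ?P = "\<lambda>pn. hom_frac (fst pn) (snd pn) \<and> \<beta> (fst pn) (snd pn) = \<beta> p n"
    have "?P (SOME pn. ?P pn)" by (rule someI[of ?P "(p, n)"]) (use that in simp)
    then show ?thesis unfolding h_def Let_def using chart_frac_eq_iff_\<beta> that by blast
  qed
  have A: "carrier A = fractions" by (rule A_eq_fractions[OF assms])
  have A_ops: "\<one>\<^bsub>A\<^esub> = 1" "\<zero>\<^bsub>A\<^esub> = 0" "f \<otimes>\<^bsub>A\<^esub> g = f * g" "f \<oplus>\<^bsub>A\<^esub> g = f + g" for f g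
    by (simp_all add: DPD_ring_def ring_on_def)
  have imageE: thesis if "f \<in> carrier A" "\<And>p n. f = \<beta> p n \<Longrightarrow> hom_frac p n \<Longrightarrow> thesis" for f thesis
    using that unfolding A fractions_def by blast
  have imageI: "\<beta> p n \<in> carrier A" if "hom_frac p n" for p n
    unfolding A fractions_def using that by blast
  have chart: "carrier (chart_ring F w) = {chart_frac F p n | p n. hom_frac p n}"
    by (simp add: chart_ring_carrier hom_frac_def w_simps)
  have hom_Const: "hom_frac (Const c) 0" for c
    by (simp add: hom_frac_def weighted_homogeneous_Const)
  have hom_0: "hom_frac 0 0" by (simp add: hom_frac_def weighted_homogeneous_0)
  have hom_torus: "hom_frac (torus_subst \<chi> \<mu> p) n" if "hom_frac p n" for \<mu> p n
    using that by (simp add: hom_frac_def torus_subst_homogeneous)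
  have DPD_const: "DPD_const c = \<beta> (Const c) 0" for c
    by (simp add: \<beta>_Const DPD_const_def cst_def)
  have "h \<in> ring_iso A (chart_ring F w)"
  proof (rule ring_iso_memI)
    show "h f \<in> carrier (chart_ring F w)" if "f \<in> carrier A" for f
      using that by (elim imageE) (auto simp: chart h)
    show "h (f \<otimes>\<^bsub>A\<^esub> g) = h f \<otimes>\<^bsub>chart_ring F w\<^esub> h g" if "f \<in> carrier A" "g \<in> carrier A" for f g
      using that by (elim imageE)
        (simp add: A_ops h chart_frac_mult hom_frac_mult flip: \<beta>_mult)
    show "h (f \<oplus>\<^bsub>A\<^esub> g) = h f \<oplus>\<^bsub>chart_ring F w\<^esub> h g" if "f \<in> carrier A" "g \<in> carrier A" for f g
      using that by (elim imageE)
        (simp add: A_ops h chart_frac_add hom_frac_add flip: \<beta>_add)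
    show "h \<one>\<^bsub>A\<^esub> = \<one>\<^bsub>chart_ring F w\<^esub>"
      using h[OF hom_Const[of 1]] by (simp add: A_ops chart_frac_one Const_def \<beta>_1)
    show "bij_betw h (carrier A) (carrier (chart_ring F w))"
      unfolding bij_betw_def
    proof
      show "inj_on h (carrier A)"
        by (rule inj_onI) (elim imageE, simp add: h chart_frac_eq_iff_\<beta>)
      show "h ` carrier A = carrier (chart_ring F w)"
        unfolding chart A fractions_def using h by force
    qed
  qed
  moreover have "h \<zero>\<^bsub>A\<^esub> = \<zero>\<^bsub>chart_ring F w\<^esub>"
    using h[OF hom_0] by (simp add: A_ops chart_frac_zero \<beta>_0)
  moreover have "DPD_const c \<in> carrier A" "h (DPD_const c) = chart_const F c" for c
    using imageI[OF hom_Const] h[OF hom_Const] by (simp_all add: DPD_const chart_frac_const)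
  moreover have "DPD_torus \<mu> f \<in> carrier A"
      "chart_torus F \<chi> \<mu> (h f) = h (DPD_torus \<mu> f)" if "\<mu> \<noteq> 0" "f \<in> carrier A" for \<mu> f
    using that(2)
    by (elim imageE; simp add: h imageI hom_torus chart_torus_frac[OF that(1) F_invariant \<chi>_simps(3)]
        flip: \<beta>_torus[OF that(1)])+
  ultimately show ?thesis
    unfolding DPD_Spec_def DPD_action_def[abs_def] D_plus_z_def D_plus_z_action_def[abs_def]
    using assms by (intro Spec_equivariantly_isomorphic)
qed

end

theorem corollary2p5:
  fixes D\<^sub>p D\<^sub>m :: "complex \<Rightarrow> rat" and D\<^sub>0 :: "complex \<Rightarrow> int"
    and d k :: nat and e\<^sub>p e\<^sub>m :: int and Q :: "complex poly"
  assumes "is_divisor D\<^sub>p" and "is_divisor D\<^sub>m" and "\<And>c. D\<^sub>p c + D\<^sub>m c \<le> 0"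
    and "normal_affine_surface (DPD_ring D\<^sub>p D\<^sub>m) DPD_const"
    and "carries_additive_action (DPD_ring D\<^sub>p D\<^sub>m) DPD_const"
    and "d \<ge> 1" and "k \<ge> 1"
    and "0 < e\<^sub>p" and "e\<^sub>p \<le> int d"
    and "D\<^sub>p = (\<lambda>c. - (of_int e\<^sub>p / of_nat d) * point_divisor 0 c)"
    and "D\<^sub>m = (\<lambda>c. - (of_int e\<^sub>m / of_nat d) * point_divisor 0 c - 1 / of_nat k * of_int (D\<^sub>0 c))"
    and "is_divisor D\<^sub>0" and "D\<^sub>0 0 = 0"
    and "Q \<noteq> 0" and "D\<^sub>0 = div_fract (Fract Q 1)"
    and "k = 1 \<or> (e\<^sub>p + e\<^sub>m = 0 \<and> reduced_divisor D\<^sub>0)"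
  defines "F \<equiv> hyp_poly e\<^sub>p e\<^sub>m d k Q"
    and "w \<equiv> hyp_weight e\<^sub>p e\<^sub>m d k Q"
  shows "(\<exists>n. weighted_homogeneous w n F) \<and>
    equivariantly_isomorphic
      (DPD_Spec D\<^sub>p D\<^sub>m) (DPD_action D\<^sub>p D\<^sub>m)
      (D_plus_z F w) (D_plus_z_action F w (hyp_character k))"
proof -
  \<comment> \<open>This is \<open>D_+ + D_- \<le> 0\<close> at the origin, where
    \<open>D\<^sub>0\<close> contributes nothing.\<close>
  have "(of_int (- e\<^sub>m) :: rat) / of_nat d \<le> of_int e\<^sub>p / of_nat d"
    using assms(3)[of 0] assms(13) by (simp add: assms(10,11) point_divisor_def)
  then have "0 \<le> e\<^sub>p + e\<^sub>m" using \<open>d \<ge> 1\<close> by (simp add: divide_le_cancel flip: of_int_minus)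
  then interpret hypersurface d k e\<^sub>p e\<^sub>m Q D\<^sub>0 D\<^sub>p D\<^sub>m
    using assms by unfold_locales auto
  have "cring (DPD_ring D\<^sub>p D\<^sub>m)"
    using assms(4) by (simp add: normal_affine_surface_def algebra_over_C_def)
  then show ?thesis
    unfolding F_def w_def using F_weight equivariantly_isomorphic_chart by blast
qed

end
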